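(* There are constants $0<C_1<C_2<\infty$ depending only on $d$ such that for all $T>0$ and all Borel $V:\mathbb{R}^d\to\mathbb{R}$, $$C_1\|K(V,T)\|_\infty\le\|S(V)\|_{T,\infty}\le C_2\|K(V,T)\|_\infty.$$
   Context: $g(t,x,y)=(4\pi t)^{-d/2}e^{-|y-x|^2/(4t)}$; $S(V,t,x,y)=\int_0^t\int_{\mathbb{R}^d}\frac{g(s,x,z)g(t-s,z,y)}{g(t,x,y)}|V(z)|\,dz\,ds$, $\|S(V)\|_{T,\infty}=\sup_{0<t\le T}\sup_{x,y}S(V,t,x,y)$. For $t>0$, $x,y\in\mathbb{R}^d$ define $K(t,x,y)=e^{-\frac{|x||y|-\langle x,y\rangle}{2}}|x|^{2-d}(1+|x||y|)^{d/2-3/2}\mathbf 1_{|x|\le t|y|}$ if $d\ge3$; $K(t,x,y)=e^{-\frac{|x||y|-\langle x,y\rangle}{2}}\log\big(1+(|x||y|)^{-1/2}\big)\mathbf 1_{|x|\le t|y|}$ if $d=2$; $K(t,x,y)=e^{-\frac{|x||y|-\langle x,y\rangle}{2}}\sqrt t(1+t|y|^2)^{-1/2}\mathbf 1_{|x|\le t|y|}$ if $d=1$. Then $K(V,t,x,y)=\int_{\mathbb{R}^d}K(t,z-x,y)|V(z)|\,dz$ and $\|K(V,t)\|_\infty=\sup_{x,y\in\mathbb{R}^d}K(V,t,x,y)$. *)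

theory Defs
  imports "HOL-Analysis.Analysis"
begin

definition heat :: "real \<Rightarrow> 'a::euclidean_space \<Rightarrow> 'a \<Rightarrow> real" where
  "heat t x y = (4 * pi * t) powr (- real DIM('a) / 2) * exp (- (norm (y - x))\<^sup>2 / (4 * t))"

definition Sfun :: "('a::euclidean_space \<Rightarrow> real) \<Rightarrow> real \<Rightarrow> 'a \<Rightarrow> 'a \<Rightarrow> ennreal" where
  "Sfun V t x y = (\<integral>\<^sup>+ s \<in> {0<..<t}. (\<integral>\<^sup>+ z. ennreal (heat s x z * heat (t - s) z y / heat t x y * \<bar>V z\<bar>) \<partial>lborel) \<partial>lborel)"

definition Snorm :: "('a::euclidean_space \<Rightarrow> real) \<Rightarrow> real \<Rightarrow> ennreal" where
  "Snorm V T = (SUP t \<in> {0<..T}. SUP x. SUP y. Sfun V t x y)"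

definition Kker :: "real \<Rightarrow> 'a::euclidean_space \<Rightarrow> 'a \<Rightarrow> real" where
  "Kker t x y =
     exp (- (norm x * norm y - inner x y) / 2) *
     (if DIM('a) \<ge> 3 then
        norm x powr (2 - real DIM('a)) * (1 + norm x * norm y) powr (real DIM('a) / 2 - 3 / 2)
      else if DIM('a) = 2 then
        ln (1 + (norm x * norm y) powr (- 1 / 2))
      else sqrt t * (1 + t * (norm y)\<^sup>2) powr (- 1 / 2)) *
     (if norm x \<le> t * norm y then 1 else 0)"

definition KV :: "('a::euclidean_space \<Rightarrow> real) \<Rightarrow> real \<Rightarrow> 'a \<Rightarrow> 'a \<Rightarrow> ennreal" where
  "KV V t x y = (\<integral>\<^sup>+ z. ennreal (Kker t (z - x) y * \<bar>V z\<bar>) \<partial>lborel)"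

definition Knorm :: "('a::euclidean_space \<Rightarrow> real) \<Rightarrow> real \<Rightarrow> ennreal" where
  "Knorm V t = (SUP x. SUP y. KV V t x y)"

end

theory Submission
  imports Defs "HOL-Probability.Distributions"
begin

text \<open>
  The quotient \<open>g(s,x,z) g(t-s,z,y) / g(t,x,y)\<close> is the density of a Brownian bridge at time \<open>s\<close>, a Gaussian of
  variance parameter \<open>s(t-s)/t\<close> centred at \<open>x + s v\<close> with \<open>v = (y-x)/t\<close>. For \<open>s \<le> t/2\<close> this parameter lies
  between \<open>s/2\<close> and \<open>s\<close>, and \<open>s \<ge> t/2\<close> is the same situation seen from \<open>y\<close>, so \<open>S\<close> is comparable with the
  potential of a Gaussian moving with constant drift. The supremum \<open>M(T)\<close> of that potential over starting points
  and drifts satisfies \<open>M(2T) \<le> 2 M(T)\<close> by the semigroup property.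

  Expanding the square, \<open>|z - s p|\<^sup>2/(4s) = (|z||p| - \<langle>z,p\<rangle>)/2 + (|z| - s|p|)\<^sup>2/(4s)\<close>, which reduces the kernel of
  the potential to a one-dimensional integral with saddle point \<open>s = |z|/|p|\<close>. If \<open>|z| \<le> T|p|\<close> the saddle point is
  in the range of integration and the kernel is comparable with \<open>K(T,z,p)\<close>. If \<open>|z| > T|p|\<close>, then up to time
  \<open>T/2\<close> the drift is negligible; the driftless kernel is dominated near the origin by \<open>K(T,z,e)\<close> with
  \<open>|e| = T\<^sup>-\<^sup>1\<^sup>/\<^sup>2\<close>, and away from it by a Gaussian average of translates of that kernel.
\<close>

section \<open>The one-dimensional saddle point integral\<close>

text \<open>The obstacle is the sharp cutoff in K: for |z| > T|p| the kernel K(T,z,p) vanishes while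
  the drift kernel does not, so no pointwise bound with the same p can hold. Only the suprema are
  comparable. As they range over all vectors and all translations, a second vector e and averages of
  translates cost only constants. The length T^(-1/2) of e makes T|e| the diffusion scale sqrt T:
  the cutoff for e is the ball of that radius, and in it the drift e changes the exponent by a
  bounded amount.

  The shape of K reflects the saddle point. Write a = |z|, b = |p|. For ab >= 1 the integral
  concentrates near a/b in a window of relative width (ab)^(-1/2). For ab <= 1 the exponent stays
  bounded between the times a^2 and a/b, and the dimension decides which times dominate: the early
  ones for d >= 3, all scales equally for d = 2 (hence the logarithm), the late ones, up to order
  min(T, 1/b^2), for d = 1.

  The comparisons shrink the time horizon, which the doubling inequality repairs. Nothing is ever
  subtracted from a norm, so infinite suprema need no separate treatment.\<close>

definition radial_integral :: "real \<Rightarrow> real \<Rightarrow> real \<Rightarrow> real \<Rightarrow> ennreal" where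
  "radial_integral d T a b = (\<integral>\<^sup>+ s \<in> {0<..T}. ennreal (s powr (- d / 2) * exp (- (a - s * b)\<^sup>2 / (4 * s))) \<partial>lborel)"

text \<open>The integrands below may be singular at 0, so the fundamental theorem of calculus is
  applied on \<open>{e..T}\<close> only. Monotone convergence along e = 1/(n+1) carries a bound
  uniform in e over to the half-open interval.\<close>

lemma nn_integral_Ioc_le:
  fixes f :: "real \<Rightarrow> ennreal"
  assumes [measurable]: "f \<in> borel_measurable borel"
    and le: "\<And>e. 0 < e \<Longrightarrow> e \<le> T \<Longrightarrow> (\<integral>\<^sup>+ s \<in> {e..T}. f s \<partial>lborel) \<le> B"
  shows "(\<integral>\<^sup>+ s \<in> {0<..T}. f s \<partial>lborel) \<le> B"
proof -
  let ?A = "\<lambda>n::nat. {inverse (real (Suc n))..T}"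
  have U: "{0<..T} = (\<Union>n. ?A n)"
  proof (intro equalityI subsetI)
    fix s assume "s \<in> {0<..T}"
    then obtain n where "inverse (real (Suc n)) < s" using reals_Archimedean by auto
    then show "s \<in> (\<Union>n. ?A n)" using \<open>s \<in> _\<close> by (auto intro!: exI[of _ n] simp del: of_nat_Suc)
  next
    fix s assume "s \<in> (\<Union>n. ?A n)"
    then obtain n where "inverse (real (Suc n)) \<le> s" "s \<le> T" by auto
    moreover have "0 < inverse (real (Suc n))" by simp
    ultimately have "0 < s" by linarith
    with \<open>s \<le> T\<close> show "s \<in> {0<..T}" by simp
  qed
  have inc: "incseq (\<lambda>n s. f s * indicator (?A n) s)"
  proof (intro incseq_SucI le_funI)
    fix n s
    have h: "inverse (real (Suc (Suc n))) \<le> inverse (real (Suc n))" by (rule le_imp_inverse_le) auto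
    show "f s * indicator (?A n) s \<le> f s * indicator (?A (Suc n)) s"
      by (intro mult_left_mono) (auto simp: indicator_def simp del: of_nat_Suc intro: order_trans[OF h])
  qed
  have "(SUP n. f s * indicator (?A n) s) = f s * indicator (\<Union>n. ?A n) s" for s
  proof (cases "s \<in> (\<Union>n. ?A n)")
    case True
    then obtain n where "s \<in> ?A n" by blast
    then have "f s \<le> (SUP n. f s * indicator (?A n) s)"
      by (intro SUP_upper2[of n]) auto
    moreover have "(SUP n. f s * indicator (?A n) s) \<le> f s"
      by (auto intro!: SUP_least simp: indicator_def)
    ultimately show ?thesis using True by (simp add: antisym)
  qed auto
  then have "(\<integral>\<^sup>+ s \<in> {0<..T}. f s \<partial>lborel) = (\<integral>\<^sup>+ s. (SUP n. f s * indicator (?A n) s) \<partial>lborel)"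
    by (simp add: U)
  also have "\<dots> = (SUP n. \<integral>\<^sup>+ s. f s * indicator (?A n) s \<partial>lborel)"
    by (intro nn_integral_monotone_convergence_SUP inc) auto
  also have "\<dots> \<le> B"
  proof (rule SUP_least)
    fix n
    show "(\<integral>\<^sup>+ s. f s * indicator (?A n) s \<partial>lborel) \<le> B"
    proof (cases "inverse (real (Suc n)) \<le> T")
      case True then show ?thesis by (intro le) auto
    next
      case False then show ?thesis by (simp add: indicator_def)
    qed
  qed
  finally show ?thesis .
qed

text \<open>
  With \<open>q = (b s - a) / sqrt (c s)\<close> the integrand is a multiple of \<open>q' exp (-q\<^sup>2)\<close>; bounding the exponential by
  \<open>1 / (1 + q\<^sup>2)\<close> gives the elementary antiderivative \<open>arctan q\<close>.
\<close>

lemma nn_integral_saddle_le: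
  fixes a b c T :: real
  assumes "a > 0" "b > 0" "c > 0"
  shows "(\<integral>\<^sup>+ s \<in> {0<..T}. ennreal ((a * s powr (- 3 / 2) + b * s powr (- 1 / 2)) * exp (- (a - s * b)\<^sup>2 / (c * s))) \<partial>lborel)
    \<le> ennreal (2 * sqrt c * pi)"
proof (rule nn_integral_Ioc_le)
  fix e :: real assume e: "0 < e" "e \<le> T"
  define q where "q = (\<lambda>s. (b * s powr (1/2) - a * s powr (- 1/2)) / sqrt c)"
  define q' where "q' = (\<lambda>s. (a * s powr (- 3 / 2) + b * s powr (- 1 / 2)) / (2 * sqrt c))"
  have q2: "(a - s * b)\<^sup>2 / (c * s) = (q s)\<^sup>2" if "s > 0" for s
  proof -
    \<comment> \<open>In terms of r = sqrt s all half-integer powers of s become rational.\<close>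
    define r where "r = s powr (1/2)"
    have r: "r > 0" using that by (simp add: r_def)
    have s: "s = r\<^sup>2" using that by (simp add: r_def powr_half_sqrt)
    have r': "s powr (- 1/2) = inverse r" by (simp add: r_def powr_minus)
    have "q s = (b * r - a / r) / sqrt c"
      unfolding q_def r' r_def[symmetric] by (simp add: divide_inverse)
    then have "(q s)\<^sup>2 = (b * r - a / r)\<^sup>2 / c"
      using assms by (simp add: power_divide)
    also have "b * r - a / r = (b * r\<^sup>2 - a) / r"
      using r by (simp add: field_simps power2_eq_square)
    finally have "(q s)\<^sup>2 = (b * s - a)\<^sup>2 / (c * s)"
      by (simp add: power_divide s)
    then show ?thesis by (simp add: power2_commute algebra_simps)
  qed
  have dq: "(q has_real_derivative q' s) (at s)" if "s > 0" for s
    unfolding q_def q'_def using that assms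
    by (auto intro!: derivative_eq_intros simp: divide_simps)
  have q'0: "q' s \<ge> 0" if "s > 0" for s
    using assms unfolding q'_def by simp
  have "(\<integral>\<^sup>+ s \<in> {e..T}. ennreal ((a * s powr (- 3 / 2) + b * s powr (- 1 / 2)) * exp (- (a - s * b)\<^sup>2 / (c * s))) \<partial>lborel)
     \<le> (\<integral>\<^sup>+ s \<in> {e..T}. ennreal (2 * sqrt c * (q' s / (1 + (q s)\<^sup>2))) \<partial>lborel)"
  proof (rule nn_integral_mono)
    fix s :: real
    show "ennreal ((a * s powr (- 3 / 2) + b * s powr (- 1 / 2)) * exp (- (a - s * b)\<^sup>2 / (c * s))) * indicator {e..T} s
      \<le> ennreal (2 * sqrt c * (q' s / (1 + (q s)\<^sup>2))) * indicator {e..T} s"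
    proof (cases "s \<in> {e..T}")
      case True
      then have s: "s > 0" using e by auto
      have "1 + (q s)\<^sup>2 \<le> exp ((q s)\<^sup>2)" by (rule exp_ge_add_one_self)
      then have "exp (- (q s)\<^sup>2) \<le> 1 / (1 + (q s)\<^sup>2)"
        by (simp add: exp_minus field_simps add_pos_nonneg)
      then have "q' s * exp (- (q s)\<^sup>2) \<le> q' s / (1 + (q s)\<^sup>2)"
        using q'0[OF s] by (metis mult_left_mono times_divide_eq_right mult.right_neutral)
      then have "2 * sqrt c * (q' s * exp (- (q s)\<^sup>2)) \<le> 2 * sqrt c * (q' s / (1 + (q s)\<^sup>2))"
        using assms by (intro mult_left_mono) auto
      moreover have "(a * s powr (- 3 / 2) + b * s powr (- 1 / 2)) = 2 * sqrt c * q' s"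
        using assms by (simp add: q'_def)
      ultimately show ?thesis using True q2[OF s] by (simp add: mult.assoc ennreal_leI)
    qed auto
  qed
  also have "\<dots> = ennreal (2 * sqrt c * arctan (q T) - 2 * sqrt c * arctan (q e))"
  proof (rule nn_integral_FTC_Icc)
    show "(\<lambda>s. 2 * sqrt c * (q' s / (1 + (q s)\<^sup>2))) \<in> borel_measurable borel"
      unfolding q_def q'_def by measurable
    fix s assume s: "s \<in> {e..T}"
    then have "s > 0" using e by auto
    then show "((\<lambda>s. 2 * sqrt c * arctan (q s)) has_real_derivative 2 * sqrt c * (q' s / (1 + (q s)\<^sup>2))) (at s)"
      by (auto intro!: derivative_eq_intros dq simp: divide_inverse)
    show "0 \<le> 2 * sqrt c * (q' s / (1 + (q s)\<^sup>2))" using q'0[OF \<open>s>0\<close>] assms by (auto intro!: mult_nonneg_nonneg divide_nonneg_nonneg)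
  qed (use e in auto)
  \<comment> \<open>The total variation of arctan is at most pi, so the bound depends neither on e
    nor on T.\<close>
  also have "\<dots> \<le> ennreal (2 * sqrt c * pi)"
  proof (rule ennreal_leI)
    have "arctan (q T) - arctan (q e) \<le> pi"
      using arctan_ubound[of "q T"] arctan_lbound[of "q e"] by linarith
    then show "2 * sqrt c * arctan (q T) - 2 * sqrt c * arctan (q e) \<le> 2 * sqrt c * pi"
      using assms by (simp add: right_diff_distrib[symmetric])
  qed
  finally show "(\<integral>\<^sup>+ s \<in> {e..T}. ennreal ((a * s powr (- 3 / 2) + b * s powr (- 1 / 2)) * exp (- (a - s * b)\<^sup>2 / (c * s))) \<partial>lborel) \<le> ennreal (2 * sqrt c * pi)" .
qed measurable

text \<open>The tangent of ln at c(m+1) bounds ln u linearly. The maximum is attained at u = cm, but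
  cm cannot serve as the base of the bound: for m = 0 the right side would be
  \<open>0 powr 0\<close>, which is 0, while the left side is positive.\<close>

lemma powr_mult_exp_le:
  fixes m c u :: real
  assumes "m \<ge> 0" "c > 0" "u > 0"
  shows "u powr m * exp (- u / c) \<le> (c * (m + 1)) powr m"
proof -
  let ?w = "c * (m + 1)"
  have w: "?w > 0" using assms by simp
  have "ln (u / ?w) \<le> u / ?w - 1" using w assms by (intro ln_le_minus_one) auto
  then have "ln u \<le> u / ?w + ln ?w" using w assms by (simp add: ln_div)
  then have "m * ln u \<le> m * (u / ?w) + m * ln ?w"
    using mult_left_mono[of "ln u" "u / ?w + ln ?w" m] assms by (simp add: distrib_left)
  also have "m * (u / ?w) \<le> u / c"
    using assms by (simp add: field_simps add_pos_nonneg)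
  finally have "exp (m * ln u - u / c) \<le> exp (m * ln ?w)" by simp
  then show ?thesis using assms w by (simp add: powr_def exp_diff exp_minus divide_inverse)
qed

lemma radial_integral_ge_window:
  assumes "0 < l" "l \<le> u" "u \<le> T" "m \<ge> 0"
    and "\<And>s. l \<le> s \<Longrightarrow> s \<le> u \<Longrightarrow> m \<le> s powr (- d / 2) * exp (- (a - s * b)\<^sup>2 / (4 * s))"
  shows "ennreal (m * (u - l)) \<le> radial_integral d T a b"
proof -
  have "ennreal (m * (u - l)) = (\<integral>\<^sup>+ s. ennreal m * indicator {l..u} s \<partial>lborel)"
    using assms by (simp add: nn_integral_cmult_indicator ennreal_mult)
  also have "\<dots> \<le> radial_integral d T a b"
    unfolding radial_integral_def using assms
    by (intro nn_integral_mono) (auto simp: indicator_def intro!: ennreal_leI)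
  finally show ?thesis .
qed

lemma drift_exponent:
  fixes a b s :: real
  assumes "s > 0"
  shows "(a - s * b)\<^sup>2 / (4 * s) = a\<^sup>2 / (4 * s) + s * b\<^sup>2 / 4 - a * b / 2"
  using assms by (simp add: field_simps power2_eq_square)

lemma power2_powr:
  fixes x m :: real
  assumes "x > 0"
  shows "(x\<^sup>2) powr m = x powr (2 * m)"
proof -
  have "x\<^sup>2 = x powr 2" using assms by simp
  then show ?thesis by (simp only: powr_powr)
qed

text \<open>Part of the exponential is spent to replace s^(-m) by a bound free of s. If s >= a/(2b),
  then 1/s <= 2b/a already suffices. If s < a/(2b), the drift covers less than half of a, so the
  exponent is at least a^2/(32 s), and this beats s^(-m).\<close>

lemma powr_drift_le:
  fixes m a b s :: real
  assumes "m \<ge> 0" "a > 0" "b > 0" "s > 0"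
  shows "s powr (- m) * exp (- (a - s * b)\<^sup>2 / (8 * s)) \<le> (32 * (m + 1)) powr m * (a powr (- 2 * m) * (1 + a * b) powr m)"
proof (cases "a \<le> 2 * s * b")
  case True
  have "s powr (- m) = (1 / s) powr m"
    using assms by (simp add: powr_minus_divide powr_divide)
  also have "\<dots> \<le> (32 * (m + 1) * (1 + a * b) / a\<^sup>2) powr m"
  proof (rule powr_mono2)
    have "1 / s \<le> 2 * b / a" using True assms by (simp add: field_simps)
    also have "\<dots> = 2 * (a * b) / a\<^sup>2" using assms by (simp add: power2_eq_square)
    also have "\<dots> \<le> 32 * (m + 1) * (1 + a * b) / a\<^sup>2"
      using assms by (intro divide_right_mono mult_mono) auto
    finally show "1 / s \<le> 32 * (m + 1) * (1 + a * b) / a\<^sup>2" .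
  qed (use assms in auto)
  also have "\<dots> = (32 * (m + 1)) powr m * (a powr (- 2 * m) * (1 + a * b) powr m)"
    using assms by (simp add: powr_mult powr_divide power2_powr powr_minus_divide)
  finally have le: "s powr (- m) \<le> (32 * (m + 1)) powr m * (a powr (- 2 * m) * (1 + a * b) powr m)" .
  have "exp (- (a - s * b)\<^sup>2 / (8 * s)) \<le> 1" using assms by (simp add: field_simps)
  then have "s powr (- m) * exp (- (a - s * b)\<^sup>2 / (8 * s)) \<le> s powr (- m) * 1"
    by (intro mult_left_mono) auto
  with le show ?thesis by simp
next
  case False
  define u where "u = a\<^sup>2 / s"
  have u: "u > 0" using assms by (simp add: u_def)
  have "(a / 2)\<^sup>2 \<le> (a - s * b)\<^sup>2" using False assms by (intro power_mono) auto
  then have "a\<^sup>2 / 4 / (8 * s) \<le> (a - s * b)\<^sup>2 / (8 * s)"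
    using assms by (intro divide_right_mono) (auto simp: power_divide)
  then have e: "exp (- (a - s * b)\<^sup>2 / (8 * s)) \<le> exp (- u / 32)"
    using assms by (simp add: u_def)
  have "s powr (- m) = u powr m * a powr (- 2 * m)"
    using assms by (simp add: u_def powr_divide power2_powr powr_minus_divide)
  then have "s powr (- m) * exp (- (a - s * b)\<^sup>2 / (8 * s)) \<le> (u powr m * exp (- u / 32)) * a powr (- 2 * m)"
    using mult_left_mono[OF e, of "u powr m * a powr (- 2 * m)"] by (simp add: algebra_simps)
  also have "\<dots> \<le> (32 * (m + 1)) powr m * a powr (- 2 * m)"
    using powr_mult_exp_le[of m 32 u] assms u by (intro mult_right_mono) auto
  also have "\<dots> \<le> (32 * (m + 1)) powr m * (a powr (- 2 * m) * (1 + a * b) powr m)"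
  proof (intro mult_left_mono)
    have "1 \<le> (1 + a * b) powr m" using assms by (intro ge_one_powr_ge_zero) auto
    then show "a powr (- 2 * m) \<le> a powr (- 2 * m) * (1 + a * b) powr m"
      by (metis mult_left_mono mult.right_neutral powr_ge_zero)
  qed auto
  finally show ?thesis .
qed

section \<open>Upper bounds for the saddle point integral, by dimension\<close>

lemma radial_integral_le_of_pointwise:
  assumes "a > 0" "b > 0" "c > 0" "K \<ge> 0"
    and "\<And>s. s > 0 \<Longrightarrow> s powr (- d / 2) * exp (- (a - s * b)\<^sup>2 / (4 * s)) \<le>
      K * ((a * s powr (- 3 / 2) + b * s powr (- 1 / 2)) * exp (- (a - s * b)\<^sup>2 / (c * s)))"
  shows "radial_integral d T a b \<le> ennreal (K * (2 * sqrt c * pi))"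
proof -
  let ?f = "\<lambda>s. (a * s powr (- 3 / 2) + b * s powr (- 1 / 2)) * exp (- (a - s * b)\<^sup>2 / (c * s))"
  have "radial_integral d T a b \<le> (\<integral>\<^sup>+ s. ennreal K * (ennreal (?f s) * indicator {0<..T} s) \<partial>lborel)"
    unfolding radial_integral_def using assms
    by (intro nn_integral_mono) (auto simp: indicator_def ennreal_mult'[symmetric] intro!: ennreal_leI)
  also have "\<dots> = ennreal K * (\<integral>\<^sup>+ s \<in> {0<..T}. ennreal (?f s) \<partial>lborel)"
    by (rule nn_integral_cmult) measurable
  also have "\<dots> \<le> ennreal K * ennreal (2 * sqrt c * pi)"
    using assms by (intro mult_left_mono nn_integral_saddle_le) auto
  finally show ?thesis using assms by (simp add: ennreal_mult)
qed

text \<open>Write s^(-d/2) = s^(-m) s^(-3/2), where d >= 3 makes m >= 0. One half of the exponent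
  absorbs s^(-m) by \<open>powr_drift_le\<close>; the other half stays with s^(-3/2) for the arctan
  bound. This is why 8 replaces 4 and sqrt 8 appears.\<close>

lemma radial_integral_le_ge3:
  fixes d :: real
  assumes d: "d \<ge> 3" and ab: "a > 0" "b > 0"
  shows "radial_integral d T a b \<le> ennreal ((32 * ((d - 3) / 2 + 1)) powr ((d - 3) / 2) * (2 * sqrt 8 * pi) *
    (a powr (2 - d) * (1 + a * b) powr (d / 2 - 3 / 2)))"
proof -
  define m where "m = (d - 3) / 2"
  define C where "C = (32 * (m + 1)) powr m"
  let ?K = "C * (a powr (- 2 * m) * (1 + a * b) powr m) / a"
  have m: "m \<ge> 0" using d by (simp add: m_def)
  have "radial_integral d T a b \<le> ennreal (?K * (2 * sqrt 8 * pi))"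
  proof (rule radial_integral_le_of_pointwise)
    fix s :: real assume s: "s > 0"
    let ?e = "exp (- (a - s * b)\<^sup>2 / (8 * s))"
    have "exp (- (a - s * b)\<^sup>2 / (4 * s)) = ?e * ?e"
      by (simp add: exp_add[symmetric] field_simps)
    moreover have "- d / 2 = - m + (- 3 / 2)" by (simp add: m_def field_simps)
    then have "s powr (- d / 2) = s powr (- m) * s powr (- 3 / 2)"
      by (simp only: powr_add)
    ultimately have "s powr (- d / 2) * exp (- (a - s * b)\<^sup>2 / (4 * s)) = (s powr (- m) * ?e) * (s powr (- 3 / 2) * ?e)"
      by simp
    also have "\<dots> \<le> (C * (a powr (- 2 * m) * (1 + a * b) powr m)) * ((a * s powr (- 3 / 2) + b * s powr (- 1 / 2)) / a * ?e)"
    proof (rule mult_mono)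
      show "s powr (- m) * ?e \<le> C * (a powr (- 2 * m) * (1 + a * b) powr m)"
        unfolding C_def using m ab s by (intro powr_drift_le) auto
      have "s powr (- 3 / 2) \<le> (a * s powr (- 3 / 2) + b * s powr (- 1 / 2)) / a"
        using ab by (simp add: field_simps)
      then show "s powr (- 3 / 2) * ?e \<le> (a * s powr (- 3 / 2) + b * s powr (- 1 / 2)) / a * ?e"
        by (rule mult_right_mono) simp
    qed (use ab in \<open>auto simp: C_def\<close>)
    finally show "s powr (- d / 2) * exp (- (a - s * b)\<^sup>2 / (4 * s)) \<le> ?K * ((a * s powr (- 3 / 2) + b * s powr (- 1 / 2)) * ?e)"
      by (simp add: field_simps)
  qed (use ab in \<open>auto simp: C_def\<close>)
  moreover have "a powr (- 2 * m) / a = a powr (2 - d)"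
  proof -
    have "2 - d = - 2 * m - 1" by (simp add: m_def)
    then show ?thesis using ab by (simp only: powr_diff) simp
  qed
  moreover have "d / 2 - 3 / 2 = m" by (simp add: m_def)
  moreover have "?K * (2 * sqrt 8 * pi) = C * (2 * sqrt 8 * pi) * (a powr (- 2 * m) / a * (1 + a * b) powr m)"
    by simp
  ultimately show ?thesis unfolding m_def[symmetric] C_def by (simp only:)
qed

text \<open>By the inequality of arithmetic and geometric means, 1/s is at most (a s^(-3/2) + b
  s^(-1/2)) / (2 sqrt(ab)), a multiple of the integrand with the arctan bound. The result has the
  right order when ab is large.\<close>

lemma radial_integral_2_le_large:
  fixes a b T :: real
  assumes "a > 0" "b > 0"
  shows "radial_integral 2 T a b \<le> ennreal (2 * pi * (a * b) powr (- 1 / 2))"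
proof -
  have "radial_integral 2 T a b \<le> ennreal ((a * b) powr (- 1 / 2) / 2 * (2 * sqrt 4 * pi))"
  proof (rule radial_integral_le_of_pointwise)
    fix s :: real assume s: "s > 0"
    define r where "r = s powr (1/2)"
    define u where "u = sqrt a" define v where "v = sqrt b"
    have pos: "r > 0" "u > 0" "v > 0" using s assms by (auto simp: r_def u_def v_def)
    have ab: "a = u\<^sup>2" "b = v\<^sup>2" using assms by (auto simp: u_def v_def)
    have "s = r\<^sup>2" using s by (simp add: r_def powr_half_sqrt)
    have sq: "s powr (x / 2) = r powr x" for x
      unfolding \<open>s = r\<^sup>2\<close> using power2_powr[of r "x / 2"] pos by simp
    have "(a * b) powr (- 1 / 2) = (u * v) powr (-1)"
    proof -
      have "(a * b) powr (- 1 / 2) = ((u * v) powr 2) powr (- 1 / 2)"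
        using pos by (simp add: ab power_mult_distrib)
      then show ?thesis by (simp add: powr_powr)
    qed
    also have "(u * v) powr (-1) = 1 / (u * v)" using pos by (simp add: powr_minus_divide)
    finally have 1: "(a * b) powr (- 1 / 2) = 1 / (u * v)" .
    have 2: "s powr (- 3 / 2) = 1 / r ^ 3"
      using pos by (subst sq) (simp add: powr_minus_divide)
    have 3: "s powr (- 1 / 2) = 1 / r"
      using pos by (subst sq) (simp add: powr_minus_divide)
    have 4: "s powr (- 2 / 2) = 1 / r ^ 2"
      using pos by (subst sq) (simp add: powr_minus_divide)
    have "1 / r ^ 2 \<le> 1 / (u * v) / 2 * (a * (1 / r ^ 3) + b * (1 / r))"
    proof -
      have eq: "1 / (u * v) / 2 * (u\<^sup>2 * (1 / r ^ 3) + v\<^sup>2 * (1 / r)) = (u\<^sup>2 + (v * r)\<^sup>2) / (2 * (u * (v * r))) / r ^ 2"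
        using pos by (simp add: divide_simps power2_eq_square power3_eq_cube)
      have "2 * (u * (v * r)) \<le> u\<^sup>2 + (v * r)\<^sup>2" using sum_squares_bound[of u "v * r"] by simp
      then have "1 \<le> (u\<^sup>2 + (v * r)\<^sup>2) / (2 * (u * (v * r)))" using pos by simp
      then show ?thesis unfolding ab eq by (intro divide_right_mono) auto
    qed
    then have "s powr (- 2 / 2) \<le> (a * b) powr (- 1 / 2) / 2 * (a * s powr (- 3 / 2) + b * s powr (- 1 / 2))"
      by (simp only: 1 2 3 4)
    then show "s powr (- 2 / 2) * exp (- (a - s * b)\<^sup>2 / (4 * s)) \<le>
      (a * b) powr (- 1 / 2) / 2 * ((a * s powr (- 3 / 2) + b * s powr (- 1 / 2)) * exp (- (a - s * b)\<^sup>2 / (4 * s)))"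
      unfolding mult.assoc[symmetric] by (intro mult_right_mono) auto
  qed (use assms in auto)
  moreover have "(a * b) powr (- 1 / 2) / 2 * (2 * sqrt 4 * pi) = 2 * pi * (a * b) powr (- 1 / 2)" by simp
  ultimately show ?thesis by (simp only:)
qed

lemma radial_integral_2_le_small:
  fixes a b T :: real
  assumes "a > 0" "b > 0" "a * b \<le> 1" "T > 0"
  shows "radial_integral 2 T a b \<le> ennreal (exp (1/2) * (32 / 15) * ln (4 / (a * b)))"
proof -
  \<comment> \<open>\<open>exp (-x) \<le> 1 / (1 + x)\<close> in both factors leaves a rational function, integrated by partial fractions.\<close>
  define \<alpha> \<beta> where "\<alpha> = a\<^sup>2 / 4" and "\<beta> = b\<^sup>2 / 4"
  have pos: "\<alpha> > 0" "\<beta> > 0" using assms by (auto simp: \<alpha>_def \<beta>_def)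
  have lam: "\<alpha> * \<beta> = (a * b / 4)\<^sup>2" by (simp add: \<alpha>_def \<beta>_def power2_eq_square)
  \<comment> \<open>The partial fractions carry the factor 1 / (1 - \<alpha> \<beta>); since ab <= 1
    it is at most 16/15, the origin of the constant 32/15.\<close>
  have "(a * b / 4)\<^sup>2 \<le> (1 / 4)\<^sup>2" using assms by (intro power_mono) auto
  then have ab16: "\<alpha> * \<beta> \<le> 1 / 16" unfolding lam by (simp add: power2_eq_square)
  define F where "F = (\<lambda>s. exp (1/2) / (1 - \<alpha> * \<beta>) * (ln (s + \<alpha>) - ln (1 + \<beta> * s)))"
  define f where "f = (\<lambda>s. exp (1/2) * (1 / ((s + \<alpha>) * (1 + \<beta> * s))))"
  have "radial_integral 2 T a b \<le> (\<integral>\<^sup>+ s \<in> {0..T}. ennreal (f s) \<partial>lborel)"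
    unfolding radial_integral_def
  proof (rule nn_integral_mono)
    fix s :: real
    show "ennreal (s powr (- 2 / 2) * exp (- (a - s * b)\<^sup>2 / (4 * s))) * indicator {0<..T} s
       \<le> ennreal (f s) * indicator {0..T} s"
    proof (cases "s \<in> {0<..T}")
      case True
      then have s: "s > 0" by simp
      have "exp (- (a - s * b)\<^sup>2 / (4 * s)) = exp (a * b / 2) * (exp (- (\<alpha> / s)) * exp (- (\<beta> * s)))"
        using drift_exponent[OF s, of a b] s by (simp add: exp_add[symmetric] \<alpha>_def \<beta>_def algebra_simps)
      also have "\<dots> \<le> exp (1/2) * (1 / (1 + \<alpha> / s) * (1 / (1 + \<beta> * s)))"
      proof -
        have *: "exp (- x) \<le> 1 / (1 + x)" if "x > 0" for x :: real
          using exp_ge_add_one_self[of x] that by (simp add: exp_minus field_simps)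
        show ?thesis using assms pos s by (intro mult_mono * ) auto
      qed
      also have "\<dots> = f s * s" unfolding f_def using pos s
        by (simp add: divide_simps)
      finally show ?thesis using True s by (simp add: powr_minus_divide field_simps ennreal_leI)
    qed auto
  qed
  also have "\<dots> = ennreal (F T - F 0)"
  proof (rule nn_integral_FTC_Icc)
    show "f \<in> borel_measurable borel" unfolding f_def by measurable
    fix s assume "s \<in> {0..T}"
    then have "0 \<le> s" by simp
    have p: "s + \<alpha> > 0" "1 + \<beta> * s > 0" "1 - \<alpha> * \<beta> > 0" using pos \<open>0 \<le> s\<close> ab16 by (auto intro: add_nonneg_pos add_pos_nonneg)
    show "f s \<ge> 0" unfolding f_def using p by auto
    have "f s = exp (1/2) / (1 - \<alpha> * \<beta>) * (1 / (s + \<alpha>) - \<beta> / (1 + \<beta> * s))"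
      unfolding f_def using p by (simp add: divide_simps) (simp add: algebra_simps)
    moreover have "((\<lambda>s. ln (s + \<alpha>) - ln (1 + \<beta> * s)) has_real_derivative (1 / (s + \<alpha>) - \<beta> / (1 + \<beta> * s))) (at s)"
      using p by (auto intro!: derivative_eq_intros)
    ultimately show "(F has_real_derivative f s) (at s)"
      unfolding F_def by (simp only: DERIV_cmult)
  qed (use assms in auto)
  also have "\<dots> \<le> ennreal (exp (1/2) * (32 / 15) * ln (4 / (a * b)))"
  proof (rule ennreal_leI)
    have p: "T + \<alpha> > 0" "1 + \<beta> * T > 0" "1 - \<alpha> * \<beta> > 0" using pos assms ab16 by (auto intro: add_nonneg_pos add_pos_nonneg)
    have "ln (T + \<alpha>) \<le> ln ((1 + \<beta> * T) / \<beta>)"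
      using p pos ab16 by (intro ln_mono) (auto simp: field_simps)
    also have "\<dots> = ln (1 + \<beta> * T) - ln \<beta>" using p pos by (simp add: ln_div)
    finally have "ln (T + \<alpha>) - ln (1 + \<beta> * T) - ln \<alpha> \<le> - ln (\<alpha> * \<beta>)"
      using pos by (simp add: ln_mult)
    also have "\<dots> = 2 * ln (4 / (a * b))"
      using assms by (simp add: lam ln_div ln_realpow ln_mult)
    finally have l: "ln (T + \<alpha>) - ln (1 + \<beta> * T) - ln \<alpha> \<le> 2 * ln (4 / (a * b))" .
    have "F T - F 0 = exp (1/2) / (1 - \<alpha> * \<beta>) * (ln (T + \<alpha>) - ln (1 + \<beta> * T) - ln \<alpha>)"
      by (simp add: F_def right_diff_distrib[symmetric] diff_divide_distrib[symmetric])
    also have "\<dots> \<le> exp (1/2) / (1 - \<alpha> * \<beta>) * (2 * ln (4 / (a * b)))"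
      using l p by (intro mult_left_mono) auto
    also have "\<dots> \<le> exp (1/2) / (15/16) * (2 * ln (4 / (a * b)))"
      using p ab16 assms by (intro mult_right_mono divide_left_mono) auto
    finally show "F T - F 0 \<le> exp (1/2) * (32 / 15) * ln (4 / (a * b))" by simp
  qed
  finally show ?thesis .
qed

text \<open>With x = (ab)^(-1/2), ln(1 + x) interpolates between the two regimes. For ab <= 1,
  4/(ab) = (2x)^2 <= (1 + x)^4 turns the logarithmic bound into a multiple of ln(1 + x); for ab > 1,
  x <= 1 gives x/2 <= ln(1 + x). The constant 20 covers both.\<close>

lemma radial_integral_2_le:
  fixes a b T :: real
  assumes "a > 0" "b > 0" "T > 0"
  shows "radial_integral 2 T a b \<le> ennreal (20 * exp (1/2) * ln (1 + (a * b) powr (- 1 / 2)))"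
proof -
  define x where "x = (a * b) powr (- 1 / 2)"
  have x: "x > 0" using assms by (simp add: x_def)
  have e: "exp (1/2) \<ge> (1::real)" by simp
  show ?thesis
  proof (cases "a * b \<le> 1")
    case True
    have "x\<^sup>2 = x powr 2" using x by simp
    also have "\<dots> = (a * b) powr (-1)" by (simp add: x_def powr_powr)
    finally have x2: "x\<^sup>2 = 1 / (a * b)" using assms by (simp add: powr_minus divide_inverse)
    have "4 / (a * b) = (2 * x)\<^sup>2" by (simp add: power_mult_distrib x2)
    also have "\<dots> \<le> ((1 + x)\<^sup>2)\<^sup>2"
      using sum_squares_bound[of 1 x] x by (intro power_mono) (auto simp: power2_sum)
    finally have "ln (4 / (a * b)) \<le> ln ((1 + x) ^ 4)"
      using assms by (intro ln_mono) (auto simp: power2_eq_square power4_eq_xxxx mult.assoc)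
    also have "\<dots> = 4 * ln (1 + x)" using x by (simp add: ln_realpow)
    finally have "exp (1/2) * (32 / 15) * ln (4 / (a * b)) \<le> exp (1/2) * (32 / 15) * (4 * ln (1 + x))"
      by (intro mult_left_mono) auto
    also have "\<dots> \<le> 20 * exp (1/2) * ln (1 + x)" using x by simp
    finally show ?thesis
      using radial_integral_2_le_small[OF assms(1,2) True assms(3)] unfolding x_def by (meson ennreal_leI order_trans)
  next
    case False
    then have "x \<le> 1" using assms unfolding x_def
      by (simp add: powr_minus_divide powr_half_sqrt)
    have "x / 2 \<le> 1 - inverse (1 + x)" using x \<open>x \<le> 1\<close>
      by (simp add: field_simps)
    also have "\<dots> \<le> ln (1 + x)"
      using ln_le_minus_one[of "inverse (1 + x)"] x by (simp add: ln_inverse)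
    finally have l: "x / 2 \<le> ln (1 + x)" .
    have "2 * pi * x \<le> 4 * pi * ln (1 + x)" using l by simp
    also have "\<dots> \<le> 16 * ln (1 + x)" using x pi_less_4 by (intro mult_right_mono) auto
    also have "\<dots> \<le> 20 * exp (1/2) * ln (1 + x)" using e x by (intro mult_right_mono, linarith) simp
    finally show ?thesis
      using radial_integral_2_le_large[OF assms(1,2), of T] unfolding x_def by (meson ennreal_leI order_trans)
  qed
qed

text \<open>The right side is of the order of min(sqrt T, 1/b). For T b^2 <= 1 the exponential is
  dropped and s^(-1/2) integrates to 2 sqrt T; otherwise s^(-1/2) is 1/b times one of the two terms
  of the saddle integrand.\<close>

lemma radial_integral_1_le:
  fixes a b T :: real
  assumes "a > 0" "b > 0" "T > 0"
  shows "radial_integral 1 T a b \<le> ennreal (8 * pi * (sqrt T * (1 + T * b\<^sup>2) powr (- 1 / 2)))"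
proof (cases "T * b\<^sup>2 \<le> 1")
  case True
  have "radial_integral 1 T a b \<le> ennreal (2 * sqrt T)"
    unfolding radial_integral_def
  proof (rule nn_integral_Ioc_le)
    fix e assume e: "0 < e" "e \<le> T"
    have "(\<integral>\<^sup>+ s \<in> {e..T}. ennreal (s powr (- 1 / 2) * exp (- (a - s * b)\<^sup>2 / (4 * s))) \<partial>lborel)
      \<le> (\<integral>\<^sup>+ s \<in> {e..T}. ennreal (s powr (- 1 / 2)) \<partial>lborel)"
    proof (rule nn_integral_mono)
      fix s
      show "ennreal (s powr (- 1 / 2) * exp (- (a - s * b)\<^sup>2 / (4 * s))) * indicator {e..T} s \<le> ennreal (s powr (- 1 / 2)) * indicator {e..T} s"
      proof (cases "s \<in> {e..T}")
        case True
        then have "exp (- (a - s * b)\<^sup>2 / (4 * s)) \<le> 1" using e by (simp add: field_simps)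
        then have "s powr (- 1 / 2) * exp (- (a - s * b)\<^sup>2 / (4 * s)) \<le> s powr (- 1 / 2) * 1"
          by (intro mult_left_mono) auto
        then show ?thesis by (auto simp: indicator_def intro!: ennreal_leI)
      qed auto
    qed
    also have "\<dots> = ennreal (2 * T powr (1/2) - 2 * e powr (1/2))"
    proof (rule nn_integral_FTC_Icc)
      fix s assume "s \<in> {e..T}"
      then show "((\<lambda>s. 2 * s powr (1/2)) has_real_derivative s powr (- 1 / 2)) (at s)"
        using e by (auto intro!: derivative_eq_intros)
    qed (use e in auto)
    also have "\<dots> \<le> ennreal (2 * sqrt T)"
      using e assms by (intro ennreal_leI) (simp add: powr_half_sqrt)
    finally show "(\<integral>\<^sup>+ s \<in> {e..T}. ennreal (s powr (- 1 / 2) * exp (- (a - s * b)\<^sup>2 / (4 * s))) \<partial>lborel) \<le> ennreal (2 * sqrt T)" .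
  qed measurable
  also have "2 * sqrt T \<le> 8 * pi * (sqrt T * (1 + T * b\<^sup>2) powr (- 1 / 2))"
  proof -
    have "sqrt (1 + T * b\<^sup>2) \<le> sqrt 4" using True by (intro real_sqrt_le_mono) auto
    moreover have "sqrt (1 + T * b\<^sup>2) > 0" using assms by (auto intro: add_pos_nonneg)
    ultimately have "1 / 2 \<le> (1 + T * b\<^sup>2) powr (- 1 / 2)"
      using assms by (simp add: powr_minus_divide powr_half_sqrt field_simps)
    then have "sqrt T * (1/2) \<le> sqrt T * (1 + T * b\<^sup>2) powr (- 1 / 2)" using assms by (intro mult_left_mono) auto
    then have "4 * (sqrt T / 2) \<le> 8 * pi * (sqrt T * (1 + T * b\<^sup>2) powr (- 1 / 2))"
      using assms pi_gt3 by (intro mult_mono) auto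
    then show ?thesis by simp
  qed
  finally show ?thesis by (simp add: ennreal_leI)
next
  case False
  have "radial_integral 1 T a b \<le> ennreal (1 / b * (2 * sqrt 4 * pi))"
  proof (rule radial_integral_le_of_pointwise)
    fix s :: real
    have "s powr (- 1 / 2) \<le> 1 / b * (a * s powr (- 3 / 2) + b * s powr (- 1 / 2))"
      using assms by (simp add: field_simps)
    then show "s powr (- 1 / 2) * exp (- (a - s * b)\<^sup>2 / (4 * s)) \<le>
      1 / b * ((a * s powr (- 3 / 2) + b * s powr (- 1 / 2)) * exp (- (a - s * b)\<^sup>2 / (4 * s)))"
      unfolding mult.assoc[symmetric] by (intro mult_right_mono) auto
  qed (use assms in auto)
  also have "1 / b * (2 * sqrt 4 * pi) \<le> 8 * pi * (sqrt T * (1 + T * b\<^sup>2) powr (- 1 / 2))"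
  proof -
    have "sqrt (1 + T * b\<^sup>2) \<le> sqrt ((2 * b)\<^sup>2 * T)"
      using False by (intro real_sqrt_le_mono) (simp add: power_mult_distrib)
    also have "\<dots> = 2 * b * sqrt T" using assms by (simp add: real_sqrt_mult)
    finally have "sqrt (1 + T * b\<^sup>2) \<le> 2 * b * sqrt T" .
    moreover have "sqrt (1 + T * b\<^sup>2) > 0" using assms by (auto intro: add_pos_nonneg)
    ultimately have "1 / (2 * b) \<le> sqrt T * (1 + T * b\<^sup>2) powr (- 1 / 2)"
      using assms by (simp add: powr_minus_divide powr_half_sqrt field_simps)
    then have "8 * pi * (1 / (2 * b)) \<le> 8 * pi * (sqrt T * (1 + T * b\<^sup>2) powr (- 1 / 2))"
      by (intro mult_left_mono) auto
    then show ?thesis by simp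
  qed
  finally show ?thesis by (simp add: ennreal_leI)
qed

section \<open>Lower bounds for the saddle point integral, by dimension\<close>

lemma radial_integral_ge_large:
  fixes a b d T :: real
  assumes "a > 0" "b > 0" "a * b \<ge> 1" "a \<le> T * b" "d \<ge> 0"
  shows "ennreal (exp (- 1 / 8) / 2 * ((a / b) powr (1 - d / 2) * (a * b) powr (- 1 / 2))) \<le> radial_integral d T a b"
proof -
  define \<sigma> where "\<sigma> = a / b"
  define k where "k = sqrt (a * b)"
  have \<sigma>: "\<sigma> > 0" "\<sigma> \<le> T" using assms by (auto simp: \<sigma>_def field_simps)
  have k: "k \<ge> 1" "k\<^sup>2 = a * b" using assms by (auto simp: k_def)
  \<comment> \<open>Laplace's method: at distance w from the saddle point \<sigma> the exponent is
    still at most 1/8, and ab >= 1 gives w <= \<sigma>/2. The window lies to the left of \<sigma>,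
    where times stay below T and s^(-d/2) is at least its value at \<sigma>.\<close>
  define w where "w = \<sigma> / (2 * k)"
  have w: "w > 0" "w \<le> \<sigma> / 2" using \<sigma> k by (auto simp: w_def field_simps)
  have bw: "b\<^sup>2 * w\<^sup>2 = \<sigma> / 4"
    using assms by (simp add: w_def power_divide power_mult_distrib k \<sigma>_def) (simp add: field_simps power2_eq_square)
  have "ennreal (\<sigma> powr (- d / 2) * exp (- 1 / 8) * (\<sigma> - (\<sigma> - w))) \<le> radial_integral d T a b"
  proof (rule radial_integral_ge_window)
    fix s assume s: "\<sigma> - w \<le> s" "s \<le> \<sigma>"
    then have s2: "s \<ge> \<sigma> / 2" "s > 0" using w \<sigma> by linarith+
    have "a - s * b = b * (\<sigma> - s)" using assms by (simp add: \<sigma>_def field_simps)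
    then have "(a - s * b)\<^sup>2 = b\<^sup>2 * (\<sigma> - s)\<^sup>2" by (simp add: power_mult_distrib)
    also have "\<dots> \<le> b\<^sup>2 * w\<^sup>2" using s by (intro mult_left_mono power_mono) auto
    finally have "(a - s * b)\<^sup>2 / (4 * s) \<le> (\<sigma> / 4) / (4 * (\<sigma> / 2))"
      using s2 \<sigma> unfolding bw by (intro frac_le) auto
    also have "\<dots> = 1 / 8" using \<sigma> by simp
    finally have "exp (- 1 / 8) \<le> exp (- (a - s * b)\<^sup>2 / (4 * s))" by simp
    moreover have "\<sigma> powr (- d / 2) \<le> s powr (- d / 2)"
      using s s2 assms by (intro powr_mono2') auto
    ultimately show "\<sigma> powr (- d / 2) * exp (- 1 / 8) \<le> s powr (- d / 2) * exp (- (a - s * b)\<^sup>2 / (4 * s))"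
      by (intro mult_mono) auto
  qed (use w \<sigma> in auto)
  also have "\<sigma> powr (- d / 2) * exp (- 1 / 8) * (\<sigma> - (\<sigma> - w)) = exp (- 1 / 8) / 2 * ((\<sigma> powr (- d / 2) * \<sigma>) * (1 / k))"
    by (simp add: w_def)
  also have "\<sigma> powr (- d / 2) * \<sigma> = \<sigma> powr (1 - d / 2)"
    using \<sigma> powr_add[of \<sigma> "- d / 2" 1] by simp
  also have "1 / k = (a * b) powr (- 1 / 2)"
    using assms by (simp add: k_def powr_minus_divide powr_half_sqrt)
  finally show ?thesis by (simp add: \<sigma>_def)
qed

text \<open>Between the diffusive time a^2 (up to a factor 2) and the saddle point, the terms
  a^2/(4s) and s b^2/4 are at most 1/2 and 1/4, and the cross term only lowers the exponent.\<close>

lemma exp_drift_ge_small: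
  fixes a b s :: real
  assumes "a > 0" "b > 0" "a * b \<le> 1" "a\<^sup>2 / 2 \<le> s" "s \<le> a / b"
  shows "exp (- 3 / 4) \<le> exp (- (a - s * b)\<^sup>2 / (4 * s))"
proof -
  have s: "s > 0" using assms by (smt (verit) zero_less_power half_gt_zero)
  have "a\<^sup>2 / (4 * s) \<le> 1 / 2" using assms s by (simp add: field_simps)
  moreover have "s * b \<le> a" using assms by (simp add: field_simps)
  then have "s * b * b \<le> a * b" using assms by (intro mult_right_mono) auto
  then have "s * b * b \<le> 1" using assms by linarith
  then have "s * b\<^sup>2 / 4 \<le> 1 / 4" by (simp add: power2_eq_square mult.assoc)
  moreover have "a * b / 2 \<ge> 0" using assms by simp
  ultimately have "(a - s * b)\<^sup>2 / (4 * s) \<le> 3 / 4"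
    unfolding drift_exponent[OF s] by linarith
  then show ?thesis by simp
qed

lemma sq_le_div:
  fixes a b :: real
  assumes "a > 0" "b > 0" "a * b \<le> 1"
  shows "a\<^sup>2 \<le> a / b"
proof -
  have "a * (a * b) \<le> a * 1" using assms by (intro mult_left_mono) auto
  then show ?thesis using assms by (simp add: field_simps power2_eq_square)
qed

text \<open>For ab >= 1 the Laplace window has the right order. For ab <= 1 the power s^(-d/2)
  decays fast enough for the earliest admissible times to dominate, and the single window from a^2/2
  to a^2 yields a^(2-d).\<close>

lemma radial_integral_ge_ge3:
  fixes a b d T :: real
  assumes d: "d \<ge> 3" and ab: "a > 0" "b > 0" "a \<le> T * b"
  shows "ennreal (exp (- 1) / (2 * 2 powr (d / 2 - 3 / 2)) * (a powr (2 - d) * (1 + a * b) powr (d / 2 - 3 / 2))) \<le> radial_integral d T a b"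
proof -
  define m where "m = d / 2 - 3 / 2"
  have m: "m \<ge> 0" using d by (simp add: m_def)
  show ?thesis
  proof (cases "a * b \<ge> 1")
    case True
    have "(1 + a * b) powr m \<le> (2 * (a * b)) powr m"
      using True m ab by (intro powr_mono2) auto
    also have "\<dots> = 2 powr m * (a * b) powr m" using ab by (simp add: powr_mult)
    finally have "exp (- 1) / (2 * 2 powr m) * (a powr (2 - d) * (1 + a * b) powr m)
      \<le> exp (- 1) / (2 * 2 powr m) * (a powr (2 - d) * (2 powr m * (a * b) powr m))"
      by (intro mult_left_mono) auto
    also have "\<dots> = exp (- 1) / 2 * (a powr (2 - d) * (a * b) powr m)" by simp
    also have "a powr (2 - d) * (a * b) powr m = (a / b) powr (1 - d / 2) * (a * b) powr (- 1 / 2)"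
    proof -
      define q where "q = 1 - d / 2"
      have "a powr (2 - d) * (a * b) powr m = a powr (2 - d + m) * b powr m"
        using ab by (simp add: powr_mult powr_add)
      also have "\<dots> = a powr (q + (- 1 / 2)) * b powr (- q + (- 1 / 2))"
        by (simp add: m_def q_def algebra_simps)
      also have "\<dots> = (a / b) powr q * (a * b) powr (- 1 / 2)"
        unfolding powr_add using ab by (simp add: powr_mult powr_divide powr_minus_divide)
      finally show ?thesis unfolding q_def .
    qed
    also have "exp (- 1) / 2 * ((a / b) powr (1 - d / 2) * (a * b) powr (- 1 / 2)) \<le>
      exp (- 1 / 8) / 2 * ((a / b) powr (1 - d / 2) * (a * b) powr (- 1 / 2))"
      by (intro mult_right_mono) auto
    finally show ?thesis
      unfolding m_def[symmetric] using radial_integral_ge_large[OF ab(1,2) True ab(3), of d] d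
      by (meson ennreal_leI order_trans order.trans[of 0 3 d] zero_le_numeral)
  next
    case False
    then have le1: "a * b \<le> 1" by simp
    have "(1 + a * b) powr m \<le> 2 powr m"
      using False m ab by (intro powr_mono2) auto
    then have "exp (- 1) / (2 * 2 powr m) * (a powr (2 - d) * (1 + a * b) powr m)
      \<le> exp (- 1) / (2 * 2 powr m) * (a powr (2 - d) * 2 powr m)"
      by (intro mult_left_mono) auto
    also have "\<dots> = exp (- 1) / 2 * a powr (2 - d)" by simp
    also have "\<dots> \<le> exp (- 3 / 4) / 2 * a powr (2 - d)" by (intro mult_right_mono) auto
    also have "\<dots> = (a\<^sup>2) powr (- d / 2) * exp (- 3 / 4) * (a\<^sup>2 - a\<^sup>2 / 2)"
    proof -
      have "a powr (2 - d) = a powr (- d) * a powr 2" unfolding powr_add[symmetric] by simp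
      then have "a powr (2 - d) = (a\<^sup>2) powr (- d / 2) * a\<^sup>2" using ab by (simp add: power2_powr)
      then show ?thesis by simp
    qed
    finally have k: "exp (- 1) / (2 * 2 powr m) * (a powr (2 - d) * (1 + a * b) powr m)
      \<le> (a\<^sup>2) powr (- d / 2) * exp (- 3 / 4) * (a\<^sup>2 - a\<^sup>2 / 2)" .
    have "a\<^sup>2 \<le> a / b" using ab le1 by (intro sq_le_div)
    moreover have "a / b \<le> T" using ab by (simp add: field_simps)
    ultimately have "ennreal ((a\<^sup>2) powr (- d / 2) * exp (- 3 / 4) * (a\<^sup>2 - a\<^sup>2 / 2)) \<le> radial_integral d T a b"
    proof (intro radial_integral_ge_window)
      fix s assume s: "a\<^sup>2 / 2 \<le> s" "s \<le> a\<^sup>2"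
      have "a\<^sup>2 > 0" using ab by simp
      then have "s > 0" using s by linarith
      then have "(a\<^sup>2) powr (- d / 2) \<le> s powr (- d / 2)" using s d by (intro powr_mono2') auto
      moreover have "exp (- 3 / 4) \<le> exp (- (a - s * b)\<^sup>2 / (4 * s))"
        using ab le1 s \<open>a\<^sup>2 \<le> a / b\<close> by (intro exp_drift_ge_small) auto
      ultimately show "(a\<^sup>2) powr (- d / 2) * exp (- 3 / 4) \<le> s powr (- d / 2) * exp (- (a - s * b)\<^sup>2 / (4 * s))"
        by (intro mult_mono) auto
    qed (use ab in auto)
    then show ?thesis unfolding m_def[symmetric] using k by (meson ennreal_leI order_trans)
  qed
qed

text \<open>For ab <= 1 no single window suffices: every scale between a^2/2 and a/b contributes
  equally, and the integral of 1/s over the whole range is ln(2/(ab)).\<close>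

lemma radial_integral_ge_2:
  fixes a b T :: real
  assumes ab: "a > 0" "b > 0" "a \<le> T * b"
  shows "ennreal (exp (- 1) / 2 * ln (1 + (a * b) powr (- 1 / 2))) \<le> radial_integral 2 T a b"
proof (cases "a * b \<ge> 1")
  case True
  have "ln (1 + (a * b) powr (- 1 / 2)) \<le> (a * b) powr (- 1 / 2)"
    by (rule ln_add_one_self_le_self) simp
  then have "exp (- 1) / 2 * ln (1 + (a * b) powr (- 1 / 2)) \<le> exp (- 1 / 8) / 2 * (a * b) powr (- 1 / 2)"
    by (intro mult_mono) auto
  moreover have "ennreal (exp (- 1 / 8) / 2 * (a * b) powr (- 1 / 2)) \<le> radial_integral 2 T a b"
    using radial_integral_ge_large[OF ab(1,2) True ab(3), of 2] ab by simp
  ultimately show ?thesis by (meson ennreal_leI order_trans)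
next
  case False
  then have le1: "a * b \<le> 1" by simp
  have sq: "a\<^sup>2 \<le> a / b" using ab le1 by (intro sq_le_div) auto
  have pos: "a\<^sup>2 / 2 > 0" using ab by simp
  have T: "a / b \<le> T" using ab by (simp add: field_simps)
  define x where "x = (a * b) powr (- 1 / 2)"
  have x: "x = 1 / sqrt (a * b)" using ab by (simp add: x_def powr_minus_divide powr_half_sqrt)
  have sq1: "sqrt (a * b) \<le> 1" "0 < sqrt (a * b)" using le1 ab by auto
  have x1: "1 \<le> x" unfolding x using sq1 by simp
  have x2: "x * x = 1 / (a * b)" unfolding x using ab by simp
  have "1 * x \<le> x * x" using x1 by (intro mult_right_mono) auto
  then have "1 + x \<le> 2 / (a * b)" using x1 x2 by simp
  then have "ln (1 + x) \<le> ln (2 / (a * b))" using x1 by (intro ln_mono) auto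
  moreover have "exp (- 1) / 2 \<le> (exp (- 3 / 4) :: real)"
  proof -
    have "exp (- 1) \<le> (exp (- 3 / 4) :: real)" "0 < (exp (- 1) :: real)" by auto
    then show ?thesis by linarith
  qed
  ultimately have "exp (- 1) / 2 * ln (1 + x) \<le> exp (- 3 / 4) * ln (2 / (a * b))"
    using x1 by (intro mult_mono) auto
  also have "\<dots> = exp (- 3 / 4) * ln (a / b) - exp (- 3 / 4) * ln (a\<^sup>2 / 2)"
  proof -
    have "2 / (a * b) = (a / b) / (a\<^sup>2 / 2)" using ab by (simp add: field_simps power2_eq_square)
    then have "ln (2 / (a * b)) = ln (a / b) - ln (a\<^sup>2 / 2)"
      using ab pos ln_div[of "a / b" "a\<^sup>2 / 2"] by (simp only: zero_less_divide_iff) simp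
    then show ?thesis by (simp add: right_diff_distrib)
  qed
  finally have "ennreal (exp (- 1) / 2 * ln (1 + x)) \<le> ennreal (exp (- 3 / 4) * ln (a / b) - exp (- 3 / 4) * ln (a\<^sup>2 / 2))"
    by (rule ennreal_leI)
  also have "\<dots> = (\<integral>\<^sup>+ s \<in> {a\<^sup>2 / 2..a / b}. ennreal (exp (- 3 / 4) * (1 / s)) \<partial>lborel)"
  proof (rule nn_integral_FTC_Icc[symmetric])
    fix s assume s: "s \<in> {a\<^sup>2 / 2..a / b}"
    then have "a\<^sup>2 / 2 \<le> s" by simp
    then have "s > 0" using pos by linarith
    then show "((\<lambda>s. exp (- 3 / 4) * ln s) has_real_derivative exp (- 3 / 4) * (1 / s)) (at s)"
      by (auto intro!: derivative_eq_intros)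
    show "0 \<le> exp (- 3 / 4) * (1 / s)" using \<open>s > 0\<close> by simp
  next
    show "a\<^sup>2 / 2 \<le> a / b" using sq pos by linarith
  qed measurable
  also have "\<dots> \<le> radial_integral 2 T a b"
    unfolding radial_integral_def
  proof (rule nn_integral_mono)
    fix s
    show "ennreal (exp (- 3 / 4) * (1 / s)) * indicator {a\<^sup>2 / 2..a / b} s
      \<le> ennreal (s powr (- 2 / 2) * exp (- (a - s * b)\<^sup>2 / (4 * s))) * indicator {0<..T} s"
    proof (cases "s \<in> {a\<^sup>2 / 2..a / b}")
      case True
      then have "a\<^sup>2 / 2 \<le> s" "s \<le> a / b" by auto
      then have s: "s > 0" "s \<le> T" using pos T by linarith+
      have "exp (- 3 / 4) \<le> exp (- (a - s * b)\<^sup>2 / (4 * s))"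
        using ab le1 True by (intro exp_drift_ge_small) auto
      then have "exp (- 3 / 4) * (1 / s) \<le> s powr (- 2 / 2) * exp (- (a - s * b)\<^sup>2 / (4 * s))"
        using s by (simp add: powr_minus_divide divide_right_mono)
      then show ?thesis using s by (auto simp: indicator_def intro!: ennreal_leI)
    qed auto
  qed
  finally show ?thesis by (simp add: x_def)
qed

text \<open>As s^(-1/2) is not integrable at infinity, the latest times dominate when ab <= 1. The
  window ends at T or at 1/b^2, whichever comes first; for ab >= 1 the Laplace window already gives
  1/b.\<close>

lemma radial_integral_ge_1:
  fixes a b T :: real
  assumes ab: "a > 0" "b > 0" "a \<le> T * b"
  shows "ennreal (exp (- 1) / 2 * (sqrt T * (1 + T * b\<^sup>2) powr (- 1 / 2))) \<le> radial_integral 1 T a b"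
proof -
  have T: "T > 0" using ab by (smt (verit) mult_nonpos_nonneg)
  have s1: "sqrt (1 + T * b\<^sup>2) \<ge> 1" using T by simp
  have s0: "1 + T * b\<^sup>2 > 0" using T by (auto intro: add_pos_nonneg)
  have kT: "sqrt T * (1 + T * b\<^sup>2) powr (- 1 / 2) \<le> sqrt T"
  proof -
    have "sqrt T / sqrt (1 + T * b\<^sup>2) \<le> sqrt T / 1" using s1 T by (intro divide_left_mono) (auto intro: add_pos_nonneg)
    then show ?thesis using T by (simp add: powr_minus_divide powr_half_sqrt)
  qed
  have "sqrt T * b = sqrt (T * b\<^sup>2)" using ab by (simp add: real_sqrt_mult)
  also have "\<dots> \<le> sqrt (1 + T * b\<^sup>2)" by simp
  finally have kb: "sqrt T * (1 + T * b\<^sup>2) powr (- 1 / 2) \<le> 1 / b"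
    using s0 T ab by (simp add: powr_minus_divide powr_half_sqrt field_simps)
  consider "a * b \<ge> 1" | "a * b \<le> 1" "T * b\<^sup>2 \<le> 1" | "a * b \<le> 1" "T * b\<^sup>2 \<ge> 1" by linarith
  then show ?thesis
  proof cases
    case 1
    have "(a / b) powr (1 - 1 / 2) * (a * b) powr (- 1 / 2) = 1 / b"
      using ab by (simp add: powr_minus_divide powr_half_sqrt real_sqrt_divide real_sqrt_mult)
    then have "ennreal (exp (- 1 / 8) / 2 * (1 / b)) \<le> radial_integral 1 T a b"
      using radial_integral_ge_large[OF ab(1,2) 1 ab(3), of 1] by simp
    moreover have "exp (- 1) / 2 * (sqrt T * (1 + T * b\<^sup>2) powr (- 1 / 2)) \<le> exp (- 1 / 8) / 2 * (1 / b)"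
      using kb ab T by (intro mult_mono) auto
    ultimately show ?thesis by (meson ennreal_leI order_trans)
  next
    case 2
    have "ennreal (T powr (- 1 / 2) * exp (- 1 / 2) * (T - T / 2)) \<le> radial_integral 1 T a b"
    proof (rule radial_integral_ge_window)
      fix s assume s: "T / 2 \<le> s" "s \<le> T"
      then have "s > 0" using T by linarith
      have "s * b \<le> T * b" "s * b \<ge> 0" using s ab \<open>s > 0\<close> by (auto intro: mult_right_mono)
      then have "\<bar>a - s * b\<bar> \<le> T * b" using ab by linarith
      then have "(a - s * b)\<^sup>2 \<le> (T * b)\<^sup>2" by (metis abs_ge_zero power2_abs power_mono)
      also have "\<dots> = T * (T * b\<^sup>2)" by (simp add: power2_eq_square)
      also have "\<dots> \<le> T * 1" using 2 T by (intro mult_left_mono) auto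
      finally have "(a - s * b)\<^sup>2 / (4 * s) \<le> T / (4 * (T / 2))"
        using s T by (intro frac_le) auto
      then have "exp (- 1 / 2) \<le> exp (- (a - s * b)\<^sup>2 / (4 * s))" using T by simp
      moreover have "T powr (- 1 / 2) \<le> s powr (- 1 / 2)" using s \<open>s > 0\<close> by (intro powr_mono2') auto
      ultimately show "T powr (- 1 / 2) * exp (- 1 / 2) \<le> s powr (- 1 / 2) * exp (- (a - s * b)\<^sup>2 / (4 * s))"
        by (intro mult_mono) auto
    qed (use T in auto)
    moreover have "T powr (- 1 / 2) * T = sqrt T"
      using T by (simp add: powr_minus_divide powr_half_sqrt real_div_sqrt)
    then have "T powr (- 1 / 2) * exp (- 1 / 2) * (T - T / 2) = exp (- 1 / 2) / 2 * sqrt T"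
      by simp
    moreover have "exp (- 1) / 2 * (sqrt T * (1 + T * b\<^sup>2) powr (- 1 / 2)) \<le> exp (- 1 / 2) / 2 * sqrt T"
      using kT T by (intro mult_mono) auto
    ultimately show ?thesis by (metis ennreal_leI order_trans)
  next
    case 3
    \<comment> \<open>At time u^2 = 1/b^2 the drift displacement s b equals the diffusion scale sqrt
      s. As ab <= 1, this time is no earlier than the saddle point a/b.\<close>
    define u where "u = 1 / b"
    have u: "u > 0" using ab by (simp add: u_def)
    have ub: "b = 1 / u" by (simp add: u_def)
    have "u\<^sup>2 \<le> T" using 3 u by (simp add: ub power_divide field_simps)
    have "a \<le> u" using 3 u by (simp add: ub field_simps)
    have pu: "(u\<^sup>2) powr (- 1 / 2) = 1 / u"
      using u power2_powr[of u "- 1 / 2"] by (simp add: powr_minus_divide)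
    have "ennreal (1 / u * exp (- 1 / 2) * (u\<^sup>2 - u\<^sup>2 / 2)) \<le> radial_integral 1 T a b"
    proof (rule radial_integral_ge_window)
      fix s assume s: "u\<^sup>2 / 2 \<le> s" "s \<le> u\<^sup>2"
      have "u\<^sup>2 > 0" using u by simp
      then have "s > 0" using s by linarith
      have "s * b \<le> u" using s u by (simp add: ub field_simps power2_eq_square)
      moreover have "s * b \<ge> 0" using ab \<open>s > 0\<close> by simp
      ultimately have "\<bar>a - s * b\<bar> \<le> u" using ab \<open>a \<le> u\<close> by linarith
      then have "(a - s * b)\<^sup>2 \<le> u\<^sup>2" by (metis abs_ge_zero power2_abs power_mono)
      then have "(a - s * b)\<^sup>2 / (4 * s) \<le> u\<^sup>2 / (4 * (u\<^sup>2 / 2))"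
        using s u by (intro frac_le) auto
      then have "exp (- 1 / 2) \<le> exp (- (a - s * b)\<^sup>2 / (4 * s))" using u by simp
      moreover have "1 / u \<le> s powr (- 1 / 2)" unfolding pu[symmetric] using s \<open>s > 0\<close> by (intro powr_mono2') auto
      ultimately show "1 / u * exp (- 1 / 2) \<le> s powr (- 1 / 2) * exp (- (a - s * b)\<^sup>2 / (4 * s))"
        by (intro mult_mono) auto
    qed (use u \<open>u\<^sup>2 \<le> T\<close> in auto)
    moreover have "1 / u * exp (- 1 / 2) * (u\<^sup>2 - u\<^sup>2 / 2) = exp (- 1 / 2) / 2 * (1 / b)"
      using u by (simp add: ub power2_eq_square)
    moreover have "exp (- 1) / 2 * (sqrt T * (1 + T * b\<^sup>2) powr (- 1 / 2)) \<le> exp (- 1 / 2) / 2 * (1 / b)"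
      using kb ab T by (intro mult_mono) auto
    ultimately show ?thesis by (metis ennreal_leI order_trans)
  qed
qed

section \<open>Comparison with the factor of K left after removing exponential and cutoff\<close>

definition radial_kernel :: "nat \<Rightarrow> real \<Rightarrow> real \<Rightarrow> real \<Rightarrow> real" where
  "radial_kernel n T a b =
    (if n \<ge> 3 then a powr (2 - real n) * (1 + a * b) powr (real n / 2 - 3 / 2)
     else if n = 2 then ln (1 + (a * b) powr (- 1 / 2))
     else sqrt T * (1 + T * b\<^sup>2) powr (- 1 / 2))"

lemma radial_kernel_nonneg: "T \<ge> 0 \<Longrightarrow> radial_kernel n T a b \<ge> 0"
  by (simp add: radial_kernel_def)

text \<open>The condition a <= T b places the saddle point a/b in the range of integration, which
  the lower bounds need, and it forces T > 0. The constants are fixed before T, a and b, so that the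
  final ones depend on the dimension alone.\<close>

lemma radial_integral_comparable:
  assumes "n > 0"
  shows "\<exists>c > 0. \<exists>C > 0. \<forall>T a b. a > 0 \<longrightarrow> b > 0 \<longrightarrow> a \<le> T * b \<longrightarrow>
    ennreal (c * radial_kernel n T a b) \<le> radial_integral n T a b \<and> radial_integral n T a b \<le> ennreal (C * radial_kernel n T a b)"
proof -
  have T: "T > 0" if "a > 0" "b > 0" "a \<le> T * b" for a b T :: real
    using that by (smt (verit) mult_nonpos_nonneg)
  have intro: ?thesis if "c > 0" "C > 0" and "\<And>T a b. a > 0 \<Longrightarrow> b > 0 \<Longrightarrow> a \<le> T * b \<Longrightarrow>
    ennreal (c * radial_kernel n T a b) \<le> radial_integral n T a b \<and> radial_integral n T a b \<le> ennreal (C * radial_kernel n T a b)" for c C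
    using that by blast
  consider "n \<ge> 3" | "n = 2" | "n = 1" using assms by linarith
  then show ?thesis
  proof cases
    case 1
    define d where "d = real n"
    have d: "d \<ge> 3" using 1 by (simp add: d_def)
    let ?c = "exp (- 1) / (2 * 2 powr (d / 2 - 3 / 2))"
    let ?C = "(32 * ((d - 3) / 2 + 1)) powr ((d - 3) / 2) * (2 * sqrt 8 * pi)"
    have "(d - 3) / 2 \<ge> 0" using d by simp
    then have "0 < 32 * ((d - 3) / 2 + 1)" by (intro mult_pos_pos add_nonneg_pos) auto
    then have pos: "?c > 0" "?C > 0" by (simp, intro mult_pos_pos) auto
    have k: "radial_kernel n T a b = a powr (2 - d) * (1 + a * b) powr (d / 2 - 3 / 2)" for T a b
      using 1 by (simp add: radial_kernel_def d_def)
    have "ennreal (?c * radial_kernel n T a b) \<le> radial_integral n T a b \<and> radial_integral n T a b \<le> ennreal (?C * radial_kernel n T a b)"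
      if "a > 0" "b > 0" "a \<le> T * b" for T a b
      unfolding k d_def[symmetric] using radial_integral_ge_ge3[OF d that] radial_integral_le_ge3[OF d that(1,2)] by blast
    with pos show ?thesis by (rule intro)
  next
    case 2
    have k: "radial_kernel n T a b = ln (1 + (a * b) powr (- 1 / 2))" for T a b
      using 2 by (simp add: radial_kernel_def)
    have "ennreal (exp (- 1) / 2 * radial_kernel n T a b) \<le> radial_integral n T a b \<and> radial_integral n T a b \<le> ennreal (20 * exp (1 / 2) * radial_kernel n T a b)"
      if "a > 0" "b > 0" "a \<le> T * b" for T a b
      unfolding k using radial_integral_ge_2[OF that] radial_integral_2_le[OF that(1,2) T[OF that]] 2 by simp
    then show ?thesis by (rule intro[rotated 2]) auto
  next
    case 3
    have k: "radial_kernel n T a b = sqrt T * (1 + T * b\<^sup>2) powr (- 1 / 2)" for T a b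
      using 3 by (simp add: radial_kernel_def)
    have "ennreal (exp (- 1) / 2 * radial_kernel n T a b) \<le> radial_integral n T a b \<and> radial_integral n T a b \<le> ennreal (8 * pi * radial_kernel n T a b)"
      if "a > 0" "b > 0" "a \<le> T * b" for T a b
      unfolding k using radial_integral_ge_1[OF that] radial_integral_1_le[OF that(1,2) T[OF that]] 3 by simp
    then show ?thesis by (rule intro[rotated 2]) auto
  qed
qed

section \<open>Gaussian kernels and Brownian bridges\<close>

definition gauss :: "real \<Rightarrow> 'a::euclidean_space \<Rightarrow> real" where
  "gauss r z = (4 * pi * r) powr (- real DIM('a) / 2) * exp (- (norm z)\<^sup>2 / (4 * r))"

lemma gauss_nonneg: "gauss r z \<ge> 0"
  by (simp add: gauss_def)

lemma measurable_gauss [measurable]: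
  assumes [measurable]: "f \<in> borel_measurable M" "g \<in> borel_measurable M"
  shows "(\<lambda>x. gauss (f x) (g x)) \<in> borel_measurable M"
  unfolding gauss_def by measurable

lemma nn_integral_lborel_shift:
  fixes f :: "'a::euclidean_space \<Rightarrow> ennreal"
  assumes [measurable]: "f \<in> borel_measurable borel"
  shows "(\<integral>\<^sup>+ z. f (z - c) \<partial>lborel) = (\<integral>\<^sup>+ z. f z \<partial>lborel)"
proof -
  have "(\<integral>\<^sup>+ z. f z \<partial>lborel) = (\<integral>\<^sup>+ z. f z \<partial>distr lborel borel ((+) (- c)))"
    by (simp add: lborel_distr_plus)
  also have "\<dots> = (\<integral>\<^sup>+ z. f (- c + z) \<partial>lborel)"
    by (rule nn_integral_distr) auto
  finally show ?thesis by simp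
qed

lemma nn_integral_gauss:
  assumes "r > 0"
  shows "(\<integral>\<^sup>+ z. ennreal (gauss r (z :: 'a::euclidean_space)) \<partial>lborel) = 1"
proof -
  \<comment> \<open>The heat kernel of the Laplacian without a factor 1/2 has variance 2r in each
    coordinate.\<close>
  let ?n = "\<lambda>x::real. normal_density 0 (sqrt (2 * r)) x"
  have n: "?n x = (4 * pi * r) powr (- 1 / 2) * exp (- x\<^sup>2 / (4 * r))" for x
    using assms by (simp add: normal_density_def powr_minus_divide powr_half_sqrt mult_ac)
  have "gauss r z = (\<Prod>b\<in>Basis. ?n (z \<bullet> b))" for z :: 'a
  proof -
    have "(\<Prod>b\<in>(Basis :: 'a set). (4 * pi * r) powr (- 1 / 2)) = (4 * pi * r) powr (- real DIM('a) / 2)"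
      using assms by (simp add: powr_power)
    moreover have "(\<Prod>b\<in>Basis. exp (- (z \<bullet> b)\<^sup>2 / (4 * r))) = exp (- (norm z)\<^sup>2 / (4 * r))"
      unfolding exp_sum[OF finite_Basis, symmetric] power2_norm_eq_inner
      by (subst euclidean_inner) (simp add: sum_negf sum_divide_distrib power2_eq_square)
    ultimately show ?thesis by (simp add: n prod.distrib gauss_def)
  qed
  then have "(\<integral>\<^sup>+ z. ennreal (gauss r (z :: 'a)) \<partial>lborel) = (\<integral>\<^sup>+ (z :: 'a). (\<Prod>b\<in>Basis. ennreal (?n (z \<bullet> b))) \<partial>lborel)"
    by (simp add: prod_ennreal)
  also have "\<dots> = (\<Prod>b\<in>(Basis :: 'a set). (\<integral>\<^sup>+ x. ennreal (?n x) \<partial>lborel))"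
    by (rule nn_integral_lborel_prod) auto
  also have "(\<integral>\<^sup>+ x. ennreal (?n x) \<partial>lborel) = 1"
    using assms prob_space.emeasure_space_1[OF prob_space_normal_density[of "sqrt (2 * r)" 0]]
    by (simp add: emeasure_density)
  finally show ?thesis by simp
qed

lemma nn_integral_gauss_shift:
  assumes "r > 0"
  shows "(\<integral>\<^sup>+ z. ennreal (gauss r (z - c :: 'a::euclidean_space)) \<partial>lborel) = 1"
  using nn_integral_lborel_shift[of "\<lambda>z. ennreal (gauss r z)" c] nn_integral_gauss[OF assms] by simp

text \<open>Completing the square in u. The identity is used twice: divided by
  \<open>gauss t w\<close> it gives the bridge density, and integrated over u it gives the semigroup
  law, since the last factor has mass 1.\<close>

lemma gauss_mult:
  fixes u w :: "'a::euclidean_space"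
  assumes "0 < s" "s < t"
  shows "gauss s u * gauss (t - s) (w - u) = gauss t w * gauss (s * (t - s) / t) (u - (s / t) *\<^sub>R w)"
proof -
  define A B C where "A = u \<bullet> u" and "B = u \<bullet> w" and "C = w \<bullet> w"
  have n1: "(norm (w - u))\<^sup>2 = A - 2 * B + C"
    unfolding power2_norm_eq_inner A_def B_def C_def by (simp add: inner_diff inner_commute)
  have n2: "(norm (u - (s / t) *\<^sub>R w))\<^sup>2 = A - 2 * (s / t) * B + (s / t)\<^sup>2 * C"
    unfolding power2_norm_eq_inner A_def B_def C_def
    by (simp add: inner_diff inner_commute power2_eq_square)
  have n3: "(norm u)\<^sup>2 = A" "(norm w)\<^sup>2 = C"
    unfolding power2_norm_eq_inner A_def C_def by auto
  define r where "r = t - s"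
  have t: "t = s + r" "r > 0" "s + r > 0" using assms by (auto simp: r_def)
  have e: "- A / (4 * s) + - (A - 2 * B + C) / (4 * r)
     = - C / (4 * t) + - (A - 2 * (s / t) * B + (s / t)\<^sup>2 * C) / (4 * (s * r / t))"
    unfolding t(1) using t(2,3) assms
    by (simp add: divide_simps power2_eq_square) (simp add: algebra_simps)
  have eq: "(4 * pi * s) * (4 * pi * r) = (4 * pi * t) * (4 * pi * (s * r / t))"
    using assms by simp
  have p: "(4 * pi * s) powr q * (4 * pi * r) powr q = (4 * pi * t) powr q * (4 * pi * (s * r / t)) powr q" for q
  proof -
    have "(4 * pi * s) powr q * (4 * pi * r) powr q = ((4 * pi * s) * (4 * pi * r)) powr q"
      by (rule powr_mult[symmetric])
    also have "\<dots> = (4 * pi * t) powr q * (4 * pi * (s * r / t)) powr q"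
      unfolding eq by (rule powr_mult)
    finally show ?thesis .
  qed
  have "gauss s u * gauss r (w - u) = ((4 * pi * s) powr (- real DIM('a) / 2) * (4 * pi * r) powr (- real DIM('a) / 2)) *
     exp (- A / (4 * s) + - (A - 2 * B + C) / (4 * r))"
    unfolding gauss_def n1 n3 exp_add by (simp only: mult_ac)
  also have "\<dots> = gauss t w * gauss (s * r / t) (u - (s / t) *\<^sub>R w)"
    unfolding p e unfolding gauss_def n2 n3 exp_add by (simp only: mult_ac)
  finally show ?thesis unfolding r_def .
qed

lemma heat_bridge:
  fixes x y z :: "'a::euclidean_space"
  assumes "0 < s" "s < t"
  shows "heat s x z * heat (t - s) z y / heat t x y = gauss (s * (t - s) / t) (z - x - s *\<^sub>R ((1 / t) *\<^sub>R (y - x)))"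
proof -
  have h: "heat t x y = gauss t (y - x)" for t and x y :: 'a
    by (simp add: heat_def gauss_def)
  have "gauss t (y - x) > 0" using assms by (simp add: gauss_def)
  moreover have "gauss s (z - x) * gauss (t - s) (y - z) = gauss t (y - x) * gauss (s * (t - s) / t) (z - x - (s / t) *\<^sub>R (y - x))"
    using gauss_mult[OF assms, of "z - x" "y - x"] by simp
  ultimately show ?thesis by (simp add: h)
qed

text \<open>The Green function up to time T of the diffusion with generator Laplacian plus p . grad.
  It takes values in \<open>ennreal\<close> because it is infinite at the origin for d >= 2.\<close>

definition drift_kernel :: "real \<Rightarrow> 'a::euclidean_space \<Rightarrow> 'a \<Rightarrow> ennreal" where
  "drift_kernel T z p = (\<integral>\<^sup>+ s \<in> {0<..T}. ennreal (gauss s (z - s *\<^sub>R p)) \<partial>lborel)"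

definition gauss_avg :: "('a::euclidean_space \<Rightarrow> real) \<Rightarrow> real \<Rightarrow> 'a \<Rightarrow> ennreal" where
  "gauss_avg V s w = (\<integral>\<^sup>+ z. ennreal (gauss s (z - w) * \<bar>V z\<bar>) \<partial>lborel)"

definition drift_potential :: "('a::euclidean_space \<Rightarrow> real) \<Rightarrow> real \<Rightarrow> 'a \<Rightarrow> 'a \<Rightarrow> ennreal" where
  "drift_potential V T x p = (\<integral>\<^sup>+ s \<in> {0<..T}. gauss_avg V s (x + s *\<^sub>R p) \<partial>lborel)"

text \<open>The quantity M(T). The supremum over p replaces the one over the endpoints of bridges;
  the supremum over x allows restarting at an intermediate time.\<close>

definition drift_norm :: "('a::euclidean_space \<Rightarrow> real) \<Rightarrow> real \<Rightarrow> ennreal" where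
  "drift_norm V T = (SUP x. SUP p. drift_potential V T x p)"

lemma drift_potential_le_norm: "drift_potential V T x p \<le> drift_norm V T"
  unfolding drift_norm_def by (meson SUP_upper2 UNIV_I order_refl)

lemma measurable_gauss_avg [measurable]:
  assumes [measurable]: "V \<in> borel_measurable borel" "f \<in> borel_measurable M" "g \<in> borel_measurable M"
  shows "(\<lambda>x. gauss_avg V (f x) (g x)) \<in> borel_measurable M"
  unfolding gauss_avg_def by measurable

text \<open>Tonelli's theorem moves the time integral inside, so that \<open>drift_potential\<close>
  and \<open>KV\<close> can be compared through their kernels, pointwise in z.\<close>

lemma drift_potential_eq:
  fixes V :: "'a::euclidean_space \<Rightarrow> real"
  assumes [measurable]: "V \<in> borel_measurable borel"
  shows "drift_potential V T x p = (\<integral>\<^sup>+ z. drift_kernel T (z - x) p * ennreal \<bar>V z\<bar> \<partial>lborel)"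
proof -
  have "drift_potential V T x p = (\<integral>\<^sup>+ s. \<integral>\<^sup>+ z. ennreal (gauss s (z - x - s *\<^sub>R p)) * indicator {0<..T} s * ennreal \<bar>V z\<bar> \<partial>lborel \<partial>lborel)"
    unfolding drift_potential_def gauss_avg_def
  proof (rule nn_integral_cong)
    fix s
    show "(\<integral>\<^sup>+ z. ennreal (gauss s (z - (x + s *\<^sub>R p)) * \<bar>V z\<bar>) \<partial>lborel) * indicator {0<..T} s
      = (\<integral>\<^sup>+ z. ennreal (gauss s (z - x - s *\<^sub>R p)) * indicator {0<..T} s * ennreal \<bar>V z\<bar> \<partial>lborel)"
      by (subst nn_integral_multc[symmetric], measurable)
        (auto intro!: nn_integral_cong simp: ennreal_mult gauss_nonneg diff_diff_eq mult_ac)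
  qed
  also have "\<dots> = (\<integral>\<^sup>+ z. \<integral>\<^sup>+ s. ennreal (gauss s (z - x - s *\<^sub>R p)) * indicator {0<..T} s * ennreal \<bar>V z\<bar> \<partial>lborel \<partial>lborel)"
    by (rule lborel_pair.Fubini') measurable
  also have "\<dots> = (\<integral>\<^sup>+ z. drift_kernel T (z - x) p * ennreal \<bar>V z\<bar> \<partial>lborel)"
    unfolding drift_kernel_def by (intro nn_integral_cong nn_integral_multc) measurable
  finally show ?thesis .
qed

lemma drift_kernel_eq_radial_integral:
  fixes z p :: "'a::euclidean_space"
  shows "drift_kernel T z p =
    ennreal ((4 * pi) powr (- real DIM('a) / 2) * exp (- (norm z * norm p - z \<bullet> p) / 2)) * radial_integral (real DIM('a)) T (norm z) (norm p)"
proof -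
  let ?d = "real DIM('a)"
  let ?E = "(4 * pi) powr (- ?d / 2) * exp (- (norm z * norm p - z \<bullet> p) / 2)"
  have "gauss s (z - s *\<^sub>R p) = ?E * (s powr (- ?d / 2) * exp (- (norm z - s * norm p)\<^sup>2 / (4 * s)))" if "s > 0" for s
  proof -
    have "(norm (z - s *\<^sub>R p))\<^sup>2 = (norm z)\<^sup>2 - 2 * s * (z \<bullet> p) + s\<^sup>2 * (norm p)\<^sup>2"
      unfolding power2_norm_eq_inner by (simp add: inner_diff inner_commute power2_eq_square)
    then have "- (norm (z - s *\<^sub>R p))\<^sup>2 / (4 * s) = - (norm z * norm p - z \<bullet> p) / 2 + - (norm z - s * norm p)\<^sup>2 / (4 * s)"
      using that by (simp add: field_simps power2_eq_square)
    moreover have "(4 * pi * s) powr (- ?d / 2) = (4 * pi) powr (- ?d / 2) * s powr (- ?d / 2)"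
      by (rule powr_mult)
    ultimately show ?thesis unfolding gauss_def by (simp only: exp_add mult_ac)
  qed
  then have "drift_kernel T z p = (\<integral>\<^sup>+ s. ennreal ?E * (ennreal (s powr (- ?d / 2) * exp (- (norm z - s * norm p)\<^sup>2 / (4 * s))) * indicator {0<..T} s) \<partial>lborel)"
    unfolding drift_kernel_def
    by (intro nn_integral_cong) (auto simp: indicator_def ennreal_mult)
  also have "\<dots> = ennreal ?E * radial_integral ?d T (norm z) (norm p)"
    unfolding radial_integral_def by (rule nn_integral_cmult) measurable
  finally show ?thesis .
qed

lemma Kker_eq_radial:
  fixes z p :: "'a::euclidean_space"
  shows "Kker T z p = exp (- (norm z * norm p - z \<bullet> p) / 2) * radial_kernel DIM('a) T (norm z) (norm p) *
    (if norm z \<le> T * norm p then 1 else 0)"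
  unfolding Kker_def radial_kernel_def by simp

lemma Kker_nonneg: "T \<ge> 0 \<Longrightarrow> Kker T z p \<ge> 0"
  unfolding Kker_eq_radial by (simp add: radial_kernel_nonneg)

text \<open>
  The origin is excluded: there \<^const>\<open>Kker\<close> has the junk value of \<open>0 powr\<close>, while the drift kernel is infinite
  for \<open>d \<ge> 2\<close>.
\<close>

lemma Kker_comparable:
  "\<exists>c > 0. \<exists>C > 0. \<forall>T > 0. \<forall>z p :: 'a::euclidean_space. z \<noteq> 0 \<longrightarrow> norm z \<le> T * norm p \<longrightarrow>
    ennreal (Kker T z p) \<le> ennreal c * drift_kernel T z p \<and> drift_kernel T z p \<le> ennreal (C * Kker T z p)"
proof -
  let ?d = "DIM('a)"
  define P where "P = (4 * pi) powr (- real ?d / 2)"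
  have P: "P > 0" by (simp add: P_def)
  obtain c C where c: "c > 0" "C > 0" and r: "\<And>T a b. a > 0 \<Longrightarrow> b > 0 \<Longrightarrow> a \<le> T * b \<Longrightarrow>
    ennreal (c * radial_kernel ?d T a b) \<le> radial_integral ?d T a b \<and> radial_integral ?d T a b \<le> ennreal (C * radial_kernel ?d T a b)"
    using radial_integral_comparable[OF DIM_positive] by blast
  have "ennreal (Kker T z p) \<le> ennreal (1 / (P * c)) * drift_kernel T z p \<and> drift_kernel T z p \<le> ennreal (P * C * Kker T z p)"
    if T: "T > 0" and z: "z \<noteq> 0" "norm z \<le> T * norm p" for T and z p :: 'a
  proof -
    have p: "norm p > 0" using z T by (metis mult_zero_right norm_ge_zero norm_le_zero_iff not_less_iff_gr_or_eq not_le)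
    define e where "e = exp (- (norm z * norm p - z \<bullet> p) / 2)"
    define k where "k = radial_kernel ?d T (norm z) (norm p)"
    have e: "e > 0" by (simp add: e_def)
    have k: "k \<ge> 0" unfolding k_def using T by (intro radial_kernel_nonneg) auto
    have K: "Kker T z p = e * k" unfolding Kker_eq_radial using z by (simp add: e_def k_def)
    have D: "drift_kernel T z p = ennreal (P * e) * radial_integral ?d T (norm z) (norm p)"
      unfolding drift_kernel_eq_radial_integral P_def e_def by simp
    have b: "ennreal (c * k) \<le> radial_integral ?d T (norm z) (norm p)" "radial_integral ?d T (norm z) (norm p) \<le> ennreal (C * k)"
      using r[of "norm z" "norm p" T] z p unfolding k_def by auto
    have "ennreal (Kker T z p) = ennreal (1 / (P * c)) * (ennreal (P * e) * ennreal (c * k))"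
      using P c e k unfolding K by (simp add: ennreal_mult[symmetric] field_simps)
    also have "\<dots> \<le> ennreal (1 / (P * c)) * drift_kernel T z p"
      unfolding D by (intro mult_left_mono b) auto
    finally have 1: "ennreal (Kker T z p) \<le> ennreal (1 / (P * c)) * drift_kernel T z p" .
    have "drift_kernel T z p \<le> ennreal (P * e) * ennreal (C * k)"
      unfolding D by (intro mult_left_mono b) auto
    also have "\<dots> = ennreal (P * C * Kker T z p)"
      using P c e k unfolding K by (simp add: ennreal_mult[symmetric] mult_ac)
    finally show ?thesis using 1 by simp
  qed
  moreover have "1 / (P * c) > 0" "P * C > 0" using P c by auto
  ultimately show ?thesis by blast
qed

text \<open>Widening a Gaussian only increases its exponential factor; the loss comes from the
  normalisation and is at most k^(d/2).\<close>

lemma gauss_le_scale: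
  fixes u :: "'a::euclidean_space"
  assumes "0 < r" "r \<le> s" "s \<le> k * r"
  shows "gauss r u \<le> k powr (real DIM('a) / 2) * gauss s u"
proof -
  let ?q = "real DIM('a) / 2"
  have k: "k > 0" using assms by (smt (verit) mult_nonpos_nonneg)
  have "(4 * pi * r) powr (- ?q) = k powr ?q * (4 * pi * (k * r)) powr (- ?q)"
    using assms k by (simp add: powr_mult powr_minus_divide)
  also have "\<dots> \<le> k powr ?q * (4 * pi * s) powr (- ?q)"
    using assms by (intro mult_left_mono powr_mono2') auto
  finally have "(4 * pi * r) powr (- ?q) \<le> k powr ?q * (4 * pi * s) powr (- ?q)" .
  moreover have "(norm u)\<^sup>2 / (4 * s) \<le> (norm u)\<^sup>2 / (4 * r)"
    using assms by (intro divide_left_mono) auto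
  then have "exp (- (norm u)\<^sup>2 / (4 * r)) \<le> exp (- (norm u)\<^sup>2 / (4 * s))" by simp
  ultimately have "gauss r u \<le> (k powr ?q * (4 * pi * s) powr (- ?q)) * exp (- (norm u)\<^sup>2 / (4 * s))"
    unfolding gauss_def minus_divide_left[symmetric] by (intro mult_mono) auto
  then show ?thesis by (simp add: gauss_def)
qed

section \<open>Bridge averages against drift potentials\<close>

definition bridge_avg :: "('a::euclidean_space \<Rightarrow> real) \<Rightarrow> real \<Rightarrow> 'a \<Rightarrow> 'a \<Rightarrow> real \<Rightarrow> ennreal" where
  "bridge_avg V t x y s = (\<integral>\<^sup>+ z. ennreal (heat s x z * heat (t - s) z y / heat t x y * \<bar>V z\<bar>) \<partial>lborel)"

text \<open>Time reversal of the bridge: by symmetry of \<open>heat\<close>, the second half of a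
  bridge from x to y is the first half of one from y to x.\<close>

lemma bridge_avg_reflect: "bridge_avg V t x y s = bridge_avg V t y x (t - s)"
proof -
  have h: "heat r a b = heat r b a" for r and a b :: 'a
    by (simp add: heat_def norm_minus_commute)
  show ?thesis unfolding bridge_avg_def
    by (simp add: h[of s x] h[of "t - s" _ y] h[of t x y] mult.commute)
qed

lemma bridge_variance:
  fixes s t :: real
  assumes "0 < s" "s \<le> t / 2"
  shows "0 < s * (t - s) / t" "s / 2 \<le> s * (t - s) / t" "s * (t - s) / t \<le> s" "s \<le> 2 * (s * (t - s) / t)"
proof -
  have t: "t > 0" using assms by simp
  then show "0 < s * (t - s) / t" using assms by (intro divide_pos_pos mult_pos_pos) auto
  have "s * (t / 2) \<le> s * (t - s)" using assms by (intro mult_left_mono) auto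
  then show "s / 2 \<le> s * (t - s) / t" "s \<le> 2 * (s * (t - s) / t)" using t by (simp_all add: field_simps)
  have "s * (t - s) \<le> s * t" using assms by (intro mult_left_mono) auto
  then show "s * (t - s) / t \<le> s" using t by (simp add: field_simps)
qed

lemma bridge_avg_le:
  fixes V :: "'a::euclidean_space \<Rightarrow> real"
  assumes [measurable]: "V \<in> borel_measurable borel" and s: "0 < s" "s \<le> t / 2"
  shows "bridge_avg V t x y s \<le> ennreal (2 powr (real DIM('a) / 2)) * gauss_avg V s (x + s *\<^sub>R ((1 / t) *\<^sub>R (y - x)))"
proof -
  let ?v = "(1 / t) *\<^sub>R (y - x)" and ?r = "s * (t - s) / t" and ?c = "2 powr (real DIM('a) / 2)"
  note r = bridge_variance(1,3,4)[OF s]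
  have "bridge_avg V t x y s \<le> (\<integral>\<^sup>+ z. ennreal ?c * ennreal (gauss s (z - (x + s *\<^sub>R ?v)) * \<bar>V z\<bar>) \<partial>lborel)"
    unfolding bridge_avg_def
  proof (rule nn_integral_mono)
    fix z :: 'a
    have "heat s x z * heat (t - s) z y / heat t x y = gauss ?r (z - (x + s *\<^sub>R ?v))"
      using heat_bridge[of s t x z y] s by (simp add: diff_diff_eq)
    also have "\<dots> * \<bar>V z\<bar> \<le> ?c * gauss s (z - (x + s *\<^sub>R ?v)) * \<bar>V z\<bar>"
      by (intro mult_right_mono gauss_le_scale r abs_ge_zero)
    finally show "ennreal (heat s x z * heat (t - s) z y / heat t x y * \<bar>V z\<bar>) \<le> ennreal ?c * ennreal (gauss s (z - (x + s *\<^sub>R ?v)) * \<bar>V z\<bar>)"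
      by (subst ennreal_mult[symmetric]) (auto simp: gauss_nonneg mult.assoc intro!: ennreal_leI)
  qed
  also have "\<dots> = ennreal ?c * gauss_avg V s (x + s *\<^sub>R ?v)"
    unfolding gauss_avg_def by (rule nn_integral_cmult) measurable
  finally show ?thesis .
qed

text \<open>A lower bound has to narrow the Gaussian, to parameter s/2, while its centre stays at x
  + s v. Measured in the time s/2 the drift is therefore 2v, and the admissible times end at
  t/4.\<close>

lemma bridge_avg_ge:
  fixes V :: "'a::euclidean_space \<Rightarrow> real"
  assumes [measurable]: "V \<in> borel_measurable borel" and s: "0 < s" "s \<le> t / 2"
  shows "gauss_avg V (s / 2) (x + s *\<^sub>R ((1 / t) *\<^sub>R (y - x))) \<le> ennreal (2 powr (real DIM('a) / 2)) * bridge_avg V t x y s"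
proof -
  let ?v = "(1 / t) *\<^sub>R (y - x)" and ?r = "s * (t - s) / t" and ?c = "2 powr (real DIM('a) / 2)"
  have s2: "0 < s / 2" "2 * (s / 2) = s" using s(1) by auto
  note r = s2(1) bridge_variance(2)[OF s] order_trans[OF bridge_variance(3)[OF s] eq_refl[OF s2(2)[symmetric]]]
  have "gauss_avg V (s / 2) (x + s *\<^sub>R ?v) \<le> (\<integral>\<^sup>+ z. ennreal ?c * ennreal (heat s x z * heat (t - s) z y / heat t x y * \<bar>V z\<bar>) \<partial>lborel)"
    unfolding gauss_avg_def
  proof (rule nn_integral_mono)
    fix z :: 'a
    have h: "heat s x z * heat (t - s) z y / heat t x y = gauss ?r (z - (x + s *\<^sub>R ?v))"
      using heat_bridge[of s t x z y] s by (simp add: diff_diff_eq)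
    have "gauss (s / 2) (z - (x + s *\<^sub>R ?v)) * \<bar>V z\<bar> \<le> ?c * gauss ?r (z - (x + s *\<^sub>R ?v)) * \<bar>V z\<bar>"
      by (intro mult_right_mono gauss_le_scale r abs_ge_zero)
    then show "ennreal (gauss (s / 2) (z - (x + s *\<^sub>R ?v)) * \<bar>V z\<bar>) \<le> ennreal ?c * ennreal (heat s x z * heat (t - s) z y / heat t x y * \<bar>V z\<bar>)"
      unfolding h by (subst ennreal_mult[symmetric]) (auto simp: gauss_nonneg mult.assoc intro!: ennreal_leI)
  qed
  also have "\<dots> = ennreal ?c * bridge_avg V t x y s"
    unfolding bridge_avg_def by (rule nn_integral_cmult) (simp add: heat_def)
  finally show ?thesis .
qed

lemma nn_integral_reflect:
  fixes f :: "real \<Rightarrow> ennreal"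
  assumes "f \<in> borel_measurable borel"
  shows "(\<integral>\<^sup>+ s. f (t - s) \<partial>lborel) = (\<integral>\<^sup>+ s. f s \<partial>lborel)"
  by (subst nn_integral_real_affine[OF assms, of "- 1" t]) simp_all

lemma drift_potential_mono: "T \<le> T' \<Longrightarrow> drift_potential V T x p \<le> drift_potential V T' x p"
  unfolding drift_potential_def by (intro nn_integral_mono) (auto simp: indicator_def)

text \<open>Each half of the bridge lasts at most T/2, so the drift norm at T/2 suffices. This
  halving is used later: for s <= T/2 and T|p| <= |z| the drift covers at most half of |z|.\<close>

lemma Snorm_le_drift_norm:
  fixes V :: "'a::euclidean_space \<Rightarrow> real"
  assumes [measurable]: "V \<in> borel_measurable borel"
  shows "Snorm V T \<le> ennreal (2 * 2 powr (real DIM('a) / 2)) * drift_norm V (T / 2)"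
  unfolding Snorm_def
proof (intro SUP_least)
  fix t and x y :: 'a assume t: "t \<in> {0<..T}"
  let ?c = "ennreal (2 powr (real DIM('a) / 2))"
  define f where "f = (\<lambda>x y s. gauss_avg V s (x + s *\<^sub>R ((1 / t) *\<^sub>R (y - x))) * indicator {0<..t / 2} s)"
  have [measurable]: "f x y \<in> borel_measurable borel" for x y
    unfolding f_def by measurable
  have f: "(\<integral>\<^sup>+ s. f x y s \<partial>lborel) \<le> drift_norm V (T / 2)" for x y
  proof -
    have "(\<integral>\<^sup>+ s. f x y s \<partial>lborel) = drift_potential V (t / 2) x ((1 / t) *\<^sub>R (y - x))"
      unfolding f_def drift_potential_def by simp
    also have "\<dots> \<le> drift_potential V (T / 2) x ((1 / t) *\<^sub>R (y - x))"
      using t by (intro drift_potential_mono) auto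
    also have "\<dots> \<le> drift_norm V (T / 2)" by (rule drift_potential_le_norm)
    finally show ?thesis .
  qed
  have "Sfun V t x y = (\<integral>\<^sup>+ s. bridge_avg V t x y s * indicator {0<..<t} s \<partial>lborel)"
    unfolding Sfun_def bridge_avg_def ..
  also have "\<dots> \<le> (\<integral>\<^sup>+ s. ?c * (f x y s + f y x (t - s)) \<partial>lborel)"
  proof (rule nn_integral_mono)
    fix s
    consider "s \<notin> {0<..<t}" | "0 < s" "s \<le> t / 2" | "0 < t - s" "t - s \<le> t / 2" by force
    then show "bridge_avg V t x y s * indicator {0<..<t} s \<le> ?c * (f x y s + f y x (t - s))"
    proof cases
      case 2
      then have "bridge_avg V t x y s \<le> ?c * f x y s"
        using bridge_avg_le[OF assms 2, of x y] by (simp add: f_def)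
      also have "\<dots> \<le> ?c * (f x y s + f y x (t - s))" by (intro mult_left_mono) auto
      finally show ?thesis by (auto simp: indicator_def)
    next
      case 3
      then have "bridge_avg V t x y s \<le> ?c * f y x (t - s)"
        using bridge_avg_le[OF assms 3, of y x] by (simp add: f_def bridge_avg_reflect[of V t x y s])
      also have "\<dots> \<le> ?c * (f x y s + f y x (t - s))" by (intro mult_left_mono) auto
      finally show ?thesis by (auto simp: indicator_def)
    qed simp
  qed
  also have "\<dots> = ?c * ((\<integral>\<^sup>+ s. f x y s \<partial>lborel) + (\<integral>\<^sup>+ s. f y x (t - s) \<partial>lborel))"
    by (simp add: nn_integral_cmult nn_integral_add)
  also have "\<dots> = ?c * ((\<integral>\<^sup>+ s. f x y s \<partial>lborel) + (\<integral>\<^sup>+ s. f y x s \<partial>lborel))"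
    by (subst nn_integral_reflect) auto
  also have "\<dots> \<le> ?c * (drift_norm V (T / 2) + drift_norm V (T / 2))"
    by (intro mult_left_mono add_mono f) auto
  also have "\<dots> = ennreal (2 * 2 powr (real DIM('a) / 2)) * drift_norm V (T / 2)"
    by (simp add: ennreal_mult mult_2[symmetric] mult_ac)
  finally show "Sfun V t x y \<le> ennreal (2 * 2 powr (real DIM('a) / 2)) * drift_norm V (T / 2)" .
qed

lemma gauss_semigroup:
  fixes z c :: "'a::euclidean_space"
  assumes "r > 0" "s > 0"
  shows "(\<integral>\<^sup>+ w. ennreal (gauss r (w - c) * gauss s (z - w)) \<partial>lborel) = ennreal (gauss (r + s) (z - c))"
proof -
  let ?\<rho> = "r * s / (r + s)" and ?m = "(r / (r + s)) *\<^sub>R (z - c)"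
  have "gauss r (w - c) * gauss s (z - w) = gauss (r + s) (z - c) * gauss ?\<rho> (w - (c + ?m))" for w
    using gauss_mult[of r "r + s" "w - c" "z - c"] assms by (simp add: diff_diff_eq)
  then have "(\<integral>\<^sup>+ w. ennreal (gauss r (w - c) * gauss s (z - w)) \<partial>lborel)
    = ennreal (gauss (r + s) (z - c)) * (\<integral>\<^sup>+ w. ennreal (gauss ?\<rho> (w - (c + ?m))) \<partial>lborel)"
    by (simp add: ennreal_mult gauss_nonneg nn_integral_cmult)
  then show ?thesis using assms by (simp add: nn_integral_gauss_shift)
qed

text \<open>The centre is written as c + c' so that c can hold the drift of a first stretch of time
  and c' that of a second, started from w.\<close>

lemma gauss_avg_semigroup:
  fixes V :: "'a::euclidean_space \<Rightarrow> real"
  assumes [measurable]: "V \<in> borel_measurable borel" and "r > 0" "s > 0"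
  shows "gauss_avg V (r + s) (c + c') = (\<integral>\<^sup>+ w. ennreal (gauss r (w - c)) * gauss_avg V s (w + c') \<partial>lborel)"
proof -
  have "(\<integral>\<^sup>+ w. ennreal (gauss r (w - c)) * gauss_avg V s (w + c') \<partial>lborel)
    = (\<integral>\<^sup>+ w. (\<integral>\<^sup>+ z. ennreal (gauss r (w - c) * gauss s (z - c' - w)) * ennreal \<bar>V z\<bar> \<partial>lborel) \<partial>lborel)"
  proof (rule nn_integral_cong)
    fix w :: 'a
    have "ennreal (gauss r (w - c)) * gauss_avg V s (w + c') =
      (\<integral>\<^sup>+ z. ennreal (gauss r (w - c)) * ennreal (gauss s (z - (w + c')) * \<bar>V z\<bar>) \<partial>lborel)"
      unfolding gauss_avg_def by (rule nn_integral_cmult[symmetric]) measurable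
    also have "\<dots> = (\<integral>\<^sup>+ z. ennreal (gauss r (w - c) * gauss s (z - c' - w)) * ennreal \<bar>V z\<bar> \<partial>lborel)"
      by (intro nn_integral_cong) (simp add: ennreal_mult gauss_nonneg diff_diff_eq mult_ac add.commute)
    finally show "ennreal (gauss r (w - c)) * gauss_avg V s (w + c') = \<dots>" .
  qed
  also have "\<dots> = (\<integral>\<^sup>+ z. (\<integral>\<^sup>+ w. ennreal (gauss r (w - c) * gauss s (z - c' - w)) * ennreal \<bar>V z\<bar> \<partial>lborel) \<partial>lborel)"
    by (rule lborel_pair.Fubini') measurable
  also have "\<dots> = (\<integral>\<^sup>+ z. ennreal (gauss (r + s) (z - c' - c)) * ennreal \<bar>V z\<bar> \<partial>lborel)"
    using assms(2,3) by (subst nn_integral_multc) (auto simp: gauss_semigroup)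
  also have "\<dots> = gauss_avg V (r + s) (c + c')"
    unfolding gauss_avg_def by (intro nn_integral_cong) (simp add: ennreal_mult gauss_nonneg diff_diff_eq add.commute)
  finally show ?thesis ..
qed

text \<open>The Markov property at time T: the contribution of the times in (T, 2T] is a Gaussian
  average, of total mass 1, of potentials over (0, T] with the same drift and new starting points w.
  Each of them is bounded by the supremum.\<close>

lemma drift_norm_double:
  fixes V :: "'a::euclidean_space \<Rightarrow> real"
  assumes [measurable]: "V \<in> borel_measurable borel" and T: "T > 0"
  shows "drift_norm V (2 * T) \<le> 2 * drift_norm V T"
  unfolding drift_norm_def[of V "2 * T"]
proof (intro SUP_least)
  fix x p :: 'a
  define f where "f = (\<lambda>s. gauss_avg V s (x + s *\<^sub>R p))"
  have [measurable]: "f \<in> borel_measurable borel" unfolding f_def by measurable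
  have "drift_potential V (2 * T) x p = (\<integral>\<^sup>+ s. f s * indicator {0<..T} s + f s * indicator {T<..2 * T} s \<partial>lborel)"
    unfolding drift_potential_def f_def using T by (intro nn_integral_cong) (auto simp: indicator_def)
  also have "\<dots> = drift_potential V T x p + (\<integral>\<^sup>+ s. f s * indicator {T<..2 * T} s \<partial>lborel)"
    unfolding drift_potential_def by (subst nn_integral_add) (auto simp: f_def)
  also have "(\<integral>\<^sup>+ s. f s * indicator {T<..2 * T} s \<partial>lborel) = (\<integral>\<^sup>+ s. f (T + s) * indicator {T<..2 * T} (T + s) \<partial>lborel)"
    using nn_integral_real_affine[of "\<lambda>s. f s * indicator {T<..2 * T} s" 1 T] by simp
  also have "\<dots> = (\<integral>\<^sup>+ s. \<integral>\<^sup>+ w. ennreal (gauss T (w - (x + T *\<^sub>R p))) * (gauss_avg V s (w + s *\<^sub>R p) * indicator {0<..T} s) \<partial>lborel \<partial>lborel)"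
  proof (rule nn_integral_cong)
    fix s
    show "f (T + s) * indicator {T<..2 * T} (T + s) =
      (\<integral>\<^sup>+ w. ennreal (gauss T (w - (x + T *\<^sub>R p))) * (gauss_avg V s (w + s *\<^sub>R p) * indicator {0<..T} s) \<partial>lborel)"
    proof (cases "s \<in> {0<..T}")
      case True
      then show ?thesis
        using gauss_avg_semigroup[OF assms, of s "x + T *\<^sub>R p" "s *\<^sub>R p"]
        by (simp add: f_def scaleR_add_left add.assoc)
    next
      case False
      then have "T + s \<notin> {T<..2 * T}" by auto
      then show ?thesis using False by simp
    qed
  qed
  also have "\<dots> = (\<integral>\<^sup>+ w. \<integral>\<^sup>+ s. ennreal (gauss T (w - (x + T *\<^sub>R p))) * (gauss_avg V s (w + s *\<^sub>R p) * indicator {0<..T} s) \<partial>lborel \<partial>lborel)"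
    by (rule lborel_pair.Fubini') measurable
  also have "\<dots> = (\<integral>\<^sup>+ w. ennreal (gauss T (w - (x + T *\<^sub>R p))) * drift_potential V T w p \<partial>lborel)"
    unfolding drift_potential_def by (intro nn_integral_cong nn_integral_cmult) measurable
  also have "\<dots> \<le> (\<integral>\<^sup>+ w. ennreal (gauss T (w - (x + T *\<^sub>R p))) * drift_norm V T \<partial>lborel)"
    by (intro nn_integral_mono mult_left_mono drift_potential_le_norm) auto
  also have "\<dots> = drift_norm V T"
    by (subst nn_integral_multc) (auto simp: nn_integral_gauss_shift T)
  finally have "drift_potential V (2 * T) x p \<le> drift_potential V T x p + drift_norm V T"
    by (simp add: add_left_mono)
  also have "\<dots> \<le> drift_norm V T + drift_norm V T"
    by (intro add_right_mono drift_potential_le_norm)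
  finally show "drift_potential V (2 * T) x p \<le> 2 * drift_norm V T"
    unfolding mult_2[of "drift_norm V T"] .
qed

text \<open>Any drift occurs as the velocity of a suitable bridge, so bridges of the single duration
  T suffice. By \<open>bridge_avg_ge\<close> the bridge at time s controls the drifted Gaussian at
  time s/2, and s <= T/2 leaves the horizon T/4.\<close>

lemma drift_norm_le_Snorm:
  fixes V :: "'a::euclidean_space \<Rightarrow> real"
  assumes [measurable]: "V \<in> borel_measurable borel" and T: "T > 0"
  shows "drift_norm V (T / 4) \<le> ennreal (2 powr (real DIM('a) / 2)) * Snorm V T"
  unfolding drift_norm_def
proof (intro SUP_least)
  fix x p :: 'a
  let ?c = "ennreal (2 powr (real DIM('a) / 2))"
  \<comment> \<open>The bridge from x to y in time T has velocity p/2, so its centre at time s is x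
    + (s/2) p: drift p at time s/2.\<close>
  define y where "y = x + (T / 2) *\<^sub>R p"
  define f where "f = (\<lambda>s. gauss_avg V s (x + s *\<^sub>R p) * indicator {0<..T / 4} s)"
  have [measurable]: "f \<in> borel_measurable borel" unfolding f_def by measurable
  have "drift_potential V (T / 4) x p = ennreal (1 / 2) * (\<integral>\<^sup>+ s. f (s / 2) \<partial>lborel)"
    using nn_integral_real_affine[of f "1 / 2" 0] unfolding drift_potential_def f_def by simp
  also have "\<dots> \<le> 1 * (\<integral>\<^sup>+ s. f (s / 2) \<partial>lborel)"
    using ennreal_leI[of "1 / 2" 1] by (intro mult_right_mono) auto
  also have "\<dots> \<le> (\<integral>\<^sup>+ s. ?c * (bridge_avg V T x y s * indicator {0<..<T} s) \<partial>lborel)"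
    unfolding mult_1
  proof (rule nn_integral_mono)
    fix s
    show "f (s / 2) \<le> ?c * (bridge_avg V T x y s * indicator {0<..<T} s)"
    proof (cases "s \<in> {0<..T / 2}")
      case True
      then show ?thesis using bridge_avg_ge[OF assms(1), of s T x y] T by (simp add: f_def y_def)
    next
      case False
      then show ?thesis by (auto simp: f_def indicator_def)
    qed
  qed
  also have "\<dots> = ?c * Sfun V T x y"
    unfolding Sfun_def bridge_avg_def by (rule nn_integral_cmult) (simp add: heat_def)
  also have "\<dots> \<le> ?c * Snorm V T"
    unfolding Snorm_def using T by (intro mult_left_mono SUP_upper2[of T] SUP_upper2[of x] SUP_upper2[of y]) auto
  finally show "drift_potential V (T / 4) x p \<le> ?c * Snorm V T" .
qed

section \<open>The norm of K bounded by the drift norm\<close>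

lemma measurable_Kker [measurable]:
  assumes [measurable]: "f \<in> borel_measurable M" "g \<in> borel_measurable M"
  shows "(\<lambda>z. Kker T (f z) (g z)) \<in> borel_measurable M"
  unfolding Kker_def by measurable

lemma KV_eq: "T \<ge> 0 \<Longrightarrow> KV V T x p = (\<integral>\<^sup>+ z. ennreal (Kker T (z - x) p) * ennreal \<bar>V z\<bar> \<partial>lborel)"
  unfolding KV_def by (simp add: ennreal_mult Kker_nonneg)

lemma AE_lborel_diff_neq_0: "AE z in lborel. z - x \<noteq> (0 :: 'a::euclidean_space)"
  using AE_lborel_singleton[of x] by simp

text \<open>Outside the cutoff K vanishes and the bound is trivial; the point z = x, not covered by
  the kernel comparison, is a null set.\<close>

lemma Knorm_le_drift_norm:
  fixes V :: "'a::euclidean_space \<Rightarrow> real"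
  assumes [measurable]: "V \<in> borel_measurable borel" and T: "T > 0"
    and c: "\<And>z p :: 'a. z \<noteq> 0 \<Longrightarrow> norm z \<le> T * norm p \<Longrightarrow> ennreal (Kker T z p) \<le> ennreal c * drift_kernel T z p"
  shows "Knorm V T \<le> ennreal c * drift_norm V T"
  unfolding Knorm_def
proof (intro SUP_least)
  fix x p :: 'a
  have [measurable]: "(\<lambda>z. drift_kernel T (z - x) p) \<in> borel_measurable borel"
    unfolding drift_kernel_def by measurable
  have "KV V T x p \<le> (\<integral>\<^sup>+ z. ennreal c * (drift_kernel T (z - x) p * ennreal \<bar>V z\<bar>) \<partial>lborel)"
    unfolding KV_eq[OF less_imp_le[OF T]]
  proof (rule nn_integral_mono_AE)
    show "AE z in lborel. ennreal (Kker T (z - x) p) * ennreal \<bar>V z\<bar> \<le> ennreal c * (drift_kernel T (z - x) p * ennreal \<bar>V z\<bar>)"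
      using AE_lborel_diff_neq_0[of x]
    proof eventually_elim
      case (elim z)
      have "ennreal (Kker T (z - x) p) \<le> ennreal c * drift_kernel T (z - x) p"
        using c[OF elim] by (cases "norm (z - x) \<le> T * norm p") (auto simp: Kker_def)
      then show ?case by (simp add: mult.assoc[symmetric] mult_right_mono)
    qed
  qed
  also have "\<dots> = ennreal c * drift_potential V T x p"
    unfolding drift_potential_eq[OF assms(1)] by (rule nn_integral_cmult) measurable
  also have "\<dots> \<le> ennreal c * drift_norm V T"
    by (intro mult_left_mono drift_potential_le_norm) auto
  finally show "KV V T x p \<le> ennreal c * drift_norm V T" .
qed

section \<open>Kernel estimates outside the cutoff |z| <= T|p|\<close>

lemma powr_neg_scale:
  fixes c x q :: real
  assumes "c > 0"
  shows "x powr (- q) = c powr q * (c * x) powr (- q)"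
  using assms by (simp add: powr_mult powr_minus_divide)

text \<open>For s <= T/2 the displacement s p has length at most |z|/2, hence |z - s p| >= |z|/2,
  and a driftless Gaussian at time 4s dominates. Times up to T/2 thereby become times up to
  2T.\<close>

lemma drift_kernel_half_le:
  fixes z p :: "'a::euclidean_space"
  assumes "T > 0" "T * norm p \<le> norm z"
  shows "drift_kernel (T / 2) z p \<le> ennreal (4 powr (real DIM('a) / 2)) * drift_kernel (2 * T) z 0"
proof -
  let ?c = "4 powr (real DIM('a) / 2)"
  define f :: "real \<Rightarrow> ennreal" where "f = (\<lambda>s. ennreal (gauss s z) * indicator {0<..2 * T} s)"
  have [measurable]: "f \<in> borel_measurable borel" unfolding f_def by measurable
  have g: "gauss s (z - s *\<^sub>R p) \<le> ?c * gauss (4 * s) z" if s: "0 < s" "s \<le> T / 2" for s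
  proof -
    have "norm (s *\<^sub>R p) \<le> norm z / 2"
    proof -
      have "s * norm p \<le> T / 2 * norm p" using s by (intro mult_right_mono) auto
      then show ?thesis using assms s by simp
    qed
    then have "norm z / 2 \<le> norm (z - s *\<^sub>R p)" using norm_triangle_ineq2[of z "s *\<^sub>R p"] by linarith
    then have "(norm z / 2)\<^sup>2 \<le> (norm (z - s *\<^sub>R p))\<^sup>2" by (intro power_mono) auto
    then have "(norm z / 2)\<^sup>2 / (4 * s) \<le> (norm (z - s *\<^sub>R p))\<^sup>2 / (4 * s)"
      using s by (intro divide_right_mono) auto
    then have "exp (- (norm (z - s *\<^sub>R p))\<^sup>2 / (4 * s)) \<le> exp (- (norm z)\<^sup>2 / (4 * (4 * s)))"
      by (simp add: power_divide)
    moreover have "(4 * pi * s) powr (- real DIM('a) / 2) = ?c * (4 * pi * (4 * s)) powr (- real DIM('a) / 2)"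
      using powr_neg_scale[of 4 "4 * pi * s" "real DIM('a) / 2"] by (simp add: mult.left_commute)
    ultimately show ?thesis unfolding gauss_def by (simp add: mult_left_mono)
  qed
  have "drift_kernel (T / 2) z p \<le> (\<integral>\<^sup>+ s. ennreal ?c * f (0 + 4 * s) \<partial>lborel)"
    unfolding drift_kernel_def
  proof (rule nn_integral_mono)
    fix s
    show "ennreal (gauss s (z - s *\<^sub>R p)) * indicator {0<..T / 2} s \<le> ennreal ?c * f (0 + 4 * s)"
      using g[of s] by (auto simp: f_def indicator_def ennreal_mult[symmetric] gauss_nonneg intro!: ennreal_leI)
  qed
  also have "\<dots> = ennreal ?c * (\<integral>\<^sup>+ s. f (0 + 4 * s) \<partial>lborel)"
    by (rule nn_integral_cmult) measurable
  \<comment> \<open>The factor 4 is inserted at a loss because it is the Jacobian that the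
    substitution of 4s absorbs.\<close>
  also have "\<dots> \<le> ennreal ?c * (4 * (\<integral>\<^sup>+ s. f (0 + 4 * s) \<partial>lborel))"
    using mult_right_mono[of "1 :: ennreal" 4 "\<integral>\<^sup>+ s. f (0 + 4 * s) \<partial>lborel"] by (intro mult_left_mono) auto
  also have "4 * (\<integral>\<^sup>+ s. f (0 + 4 * s) \<partial>lborel) = (\<integral>\<^sup>+ s. f s \<partial>lborel)"
    by (subst nn_integral_real_affine[of f 4 0]) auto
  also have "\<dots> = drift_kernel (2 * T) z 0"
    unfolding drift_kernel_def f_def by simp
  finally show ?thesis .
qed

text \<open>Away from early times near the origin, one fixed Gaussian dominates. For s > T the
  normalisations are comparable. For s <= T and |z|^2 >= T, half of the exponent absorbs s^(-d/2);
  the other half is |z|^2/(8s) >= |z|^2/(16T), the exponent of parameter 4T.\<close>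

lemma gauss_le_far:
  fixes z :: "'a::euclidean_space"
  assumes "T > 0" "0 < s" "s \<le> 2 * T" "T < s \<or> T \<le> (norm z)\<^sup>2"
  shows "gauss s z \<le> 4 powr (real DIM('a) / 2) * (8 * (real DIM('a) / 2 + 1)) powr (real DIM('a) / 2) * gauss (4 * T) z"
proof -
  define q where "q = real DIM('a) / 2"
  have q: "q \<ge> 0" by (simp add: q_def)
  define B where "B = (8 * (q + 1)) powr q"
  have B1: "B \<ge> 1" unfolding B_def using q by (intro ge_one_powr_ge_zero) auto
  define N where "N = (norm z)\<^sup>2"
  have N: "N \<ge> 0" by (simp add: N_def)
  have c: "(4 * pi * (4 * T)) powr (- q) * 4 powr q = (4 * pi * T) powr (- q)"
    using powr_neg_scale[of 4 "4 * pi * T" q] by (simp add: mult_ac)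
  have e: "exp (- N / (8 * s)) \<le> exp (- N / (16 * T))"
    using assms N by (simp add: frac_le)
  have main: "s powr (- q) * exp (- N / (4 * s)) \<le> B * T powr (- q) * exp (- N / (16 * T))"
  proof (cases "T < s")
    case True
    have "N / (16 * T) \<le> N / (4 * s)" using assms N by (intro divide_left_mono) auto
    then have "exp (- N / (4 * s)) \<le> exp (- N / (16 * T))" by simp
    moreover have "s powr (- q) \<le> T powr (- q)" using True assms q by (intro powr_mono2') auto
    moreover have "T powr (- q) \<le> B * T powr (- q)" using mult_right_mono[OF B1, of "T powr (- q)"] by simp
    ultimately show ?thesis using B1 by (intro mult_mono) auto
  next
    case False
    then have NT: "T \<le> N" using assms by (simp add: N_def)
    define u where "u = T / s"
    have u: "u > 0" using assms by (simp add: u_def)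
    have "s powr (- q) = u powr q * T powr (- q)"
      using assms by (simp add: u_def powr_divide powr_minus_divide)
    moreover have "exp (- N / (4 * s)) = exp (- N / (8 * s)) * exp (- N / (8 * s))"
      by (simp add: exp_add[symmetric] field_simps)
    moreover have "exp (- N / (8 * s)) \<le> exp (- u / 8)"
    proof -
      have "T / (8 * s) \<le> N / (8 * s)" using NT assms by (intro divide_right_mono) auto
      then show ?thesis by (simp add: u_def mult.commute)
    qed
    ultimately have "s powr (- q) * exp (- N / (4 * s)) \<le> (u powr q * T powr (- q)) * (exp (- u / 8) * exp (- N / (16 * T)))"
      using e by (simp only:) (intro mult_left_mono mult_mono, auto)
    also have "\<dots> = (u powr q * exp (- u / 8)) * T powr (- q) * exp (- N / (16 * T))" by simp
    also have "\<dots> \<le> B * T powr (- q) * exp (- N / (16 * T))"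
      unfolding B_def using powr_mult_exp_le[of q 8 u] q u by (intro mult_right_mono) auto
    finally show ?thesis .
  qed
  have "gauss s z = (4 * pi) powr (- q) * (s powr (- q) * exp (- N / (4 * s)))"
    unfolding gauss_def q_def N_def by (simp add: powr_mult)
  also have "\<dots> \<le> (4 * pi) powr (- q) * (B * T powr (- q) * exp (- N / (16 * T)))"
    using main by (intro mult_left_mono) auto
  also have "\<dots> = B * (4 * pi * T) powr (- q) * exp (- N / (16 * T))"
    by (simp add: powr_mult)
  also have "\<dots> = 4 powr q * B * gauss (4 * T) z"
    unfolding c[symmetric] unfolding gauss_def q_def N_def by simp
  finally show ?thesis unfolding B_def q_def .
qed

text \<open>For |z| <= sqrt T and s <= T both |z||p| and s|p|^2 are at most 1, so inserting a drift
  of length T^(-1/2) raises the exponent by less than 1, in whatever direction it points. All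
  remaining s and z fall under \<open>gauss_le_far\<close>.\<close>

lemma drift_kernel_zero_le:
  fixes z p :: "'a::euclidean_space"
  assumes T: "T > 0" and p: "norm p = 1 / sqrt T"
  defines "C \<equiv> 4 powr (real DIM('a) / 2) * (8 * (real DIM('a) / 2 + 1)) powr (real DIM('a) / 2)"
  shows "drift_kernel (2 * T) z 0 \<le> ennreal (exp 1) * (drift_kernel T z p * indicator (cball 0 (sqrt T)) z)
    + ennreal (2 * C) * ennreal (T * gauss (4 * T) z)"
proof -
  let ?I = "indicator (cball 0 (sqrt T)) z :: ennreal"
  have C: "C \<ge> 0" by (simp add: C_def)
  have near: "gauss s z \<le> exp 1 * gauss s (z - s *\<^sub>R p)" if s: "0 < s" "s \<le> T" and z: "norm z \<le> sqrt T" for s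
  proof -
    have "z \<bullet> p \<le> norm z * norm p" by (rule norm_cauchy_schwarz)
    moreover have "- (z \<bullet> p) \<le> norm z * norm p" using norm_cauchy_schwarz[of "- z" p] by simp
    moreover have "norm z * norm p \<le> sqrt T * (1 / sqrt T)"
      unfolding p using z T by (intro mult_right_mono) auto
    ultimately have zp: "- (z \<bullet> p) \<le> 1" using T by simp
    have pp: "(norm p)\<^sup>2 = 1 / T" using T by (simp add: p power_divide)
    have "(norm (z - s *\<^sub>R p))\<^sup>2 = (norm z)\<^sup>2 - 2 * s * (z \<bullet> p) + s\<^sup>2 * (norm p)\<^sup>2"
      unfolding power2_norm_eq_inner by (simp add: inner_diff inner_commute power2_eq_square)
    then have "(norm (z - s *\<^sub>R p))\<^sup>2 / (4 * s) = (norm z)\<^sup>2 / (4 * s) - (z \<bullet> p) / 2 + s * (1 / T) / 4"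
      unfolding pp using s T by (simp add: field_simps power2_eq_square)
    moreover have "s * (1 / T) \<le> 1" using s T by simp
    moreover have "A - c / 2 + u / 4 \<le> A + 1" if "u \<le> 1" "- c \<le> 1" for A c u :: real
      using that by linarith
    ultimately have "(norm (z - s *\<^sub>R p))\<^sup>2 / (4 * s) \<le> (norm z)\<^sup>2 / (4 * s) + 1"
      using zp by (simp only:)
    then have "exp (- (norm z)\<^sup>2 / (4 * s)) \<le> exp (1 + - (norm (z - s *\<^sub>R p))\<^sup>2 / (4 * s))" by simp
    then have "exp (- (norm z)\<^sup>2 / (4 * s)) \<le> exp 1 * exp (- (norm (z - s *\<^sub>R p))\<^sup>2 / (4 * s))"
      by (simp only: exp_add)
    then have "(4 * pi * s) powr (- real DIM('a) / 2) * exp (- (norm z)\<^sup>2 / (4 * s)) \<le>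
      (4 * pi * s) powr (- real DIM('a) / 2) * (exp 1 * exp (- (norm (z - s *\<^sub>R p))\<^sup>2 / (4 * s)))"
      by (rule mult_left_mono) simp
    then show ?thesis unfolding gauss_def by (simp only: mult.left_commute)
  qed
  have "drift_kernel (2 * T) z 0 \<le> (\<integral>\<^sup>+ s. ennreal (exp 1) * ?I * (ennreal (gauss s (z - s *\<^sub>R p)) * indicator {0<..T} s)
      + ennreal (C * gauss (4 * T) z) * indicator {0<..2 * T} s \<partial>lborel)"
    unfolding drift_kernel_def
  proof (rule nn_integral_mono)
    fix s
    show "ennreal (gauss s (z - s *\<^sub>R 0)) * indicator {0<..2 * T} s \<le> ennreal (exp 1) * ?I * (ennreal (gauss s (z - s *\<^sub>R p)) * indicator {0<..T} s)
      + ennreal (C * gauss (4 * T) z) * indicator {0<..2 * T} s"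
    proof (cases "s \<in> {0<..2 * T}")
      case True
      then have s: "0 < s" "s \<le> 2 * T" by auto
      show ?thesis
      proof (cases "T < s \<or> T \<le> (norm z)\<^sup>2")
        case far: True
        have "ennreal (gauss s z) \<le> ennreal (C * gauss (4 * T) z)"
          unfolding C_def using gauss_le_far[OF T s far] by (rule ennreal_leI)
        then show ?thesis using True by (simp add: add_increasing)
      next
        case False
        then have "(norm z)\<^sup>2 \<le> (sqrt T)\<^sup>2" "s \<le> T" using T by auto
        then have z: "norm z \<le> sqrt T" using T by (intro power2_le_imp_le[of "norm z" "sqrt T"]) auto
        have "ennreal (gauss s z) \<le> ennreal (exp 1) * ennreal (gauss s (z - s *\<^sub>R p))"
          using near[OF s(1) \<open>s \<le> T\<close> z] by (subst ennreal_mult[symmetric]) (auto simp: gauss_nonneg intro: ennreal_leI)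
        then show ?thesis using True z \<open>s \<le> T\<close> by (simp add: add_increasing2)
      qed
    qed simp
  qed
  \<comment> \<open>The far bound is constant in s; the length 2T of the time interval gives the 2
    in \<open>2 * C\<close> and the T in front of the Gaussian.\<close>
  also have "\<dots> = ennreal (exp 1) * ?I * drift_kernel T z p + ennreal (C * gauss (4 * T) z) * ennreal (2 * T)"
    unfolding drift_kernel_def using T by (simp add: nn_integral_add nn_integral_cmult nn_integral_cmult_indicator)
  also have "\<dots> = ennreal (exp 1) * (drift_kernel T z p * ?I) + ennreal (2 * C) * ennreal (T * gauss (4 * T) z)"
    using T C by (simp add: ennreal_mult[symmetric] gauss_nonneg mult_ac)
  finally show ?thesis .
qed

text \<open>For z in the ball and times in [T/2, T], |z - s p| is at most 2 sqrt T, so the Gaussian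
  has size T^(-d/2); the time span T/2 supplies the remaining power of T.\<close>

lemma ball_le_drift_kernel:
  fixes z p :: "'a::euclidean_space"
  assumes T: "T > 0" and p: "norm p = 1 / sqrt T" and z: "norm z \<le> sqrt T"
  shows "ennreal (T powr (1 - real DIM('a) / 2)) \<le> ennreal (2 * exp 2 * (4 * pi) powr (real DIM('a) / 2)) * drift_kernel T z p"
proof -
  define q where "q = real DIM('a) / 2"
  define m where "m = (4 * pi * T) powr (- q) * exp (- 2)"
  have m: "m \<ge> 0" by (simp add: m_def)
  have "ennreal (m * (T - T / 2)) = (\<integral>\<^sup>+ s. ennreal m * indicator {T / 2..T} s \<partial>lborel)"
    using T m by (subst nn_integral_cmult_indicator) (auto simp: ennreal_mult[symmetric])
  also have "\<dots> \<le> drift_kernel T z p"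
    unfolding drift_kernel_def
  proof (rule nn_integral_mono)
    fix s
    show "ennreal m * indicator {T / 2..T} s \<le> ennreal (gauss s (z - s *\<^sub>R p)) * indicator {0<..T} s"
    proof (cases "s \<in> {T / 2..T}")
      case True
      then have s: "0 < s" "s \<le> T" "T / 2 \<le> s" using T by auto
      have "norm (s *\<^sub>R p) \<le> sqrt T"
      proof -
        have "s * (1 / sqrt T) \<le> T * (1 / sqrt T)" using s T by (intro mult_right_mono) auto
        then show ?thesis using s T by (simp add: p real_div_sqrt)
      qed
      then have "norm (z - s *\<^sub>R p) \<le> 2 * sqrt T" using z norm_triangle_ineq4[of z "s *\<^sub>R p"] by linarith
      then have "(norm (z - s *\<^sub>R p))\<^sup>2 \<le> (2 * sqrt T)\<^sup>2" by (intro power_mono) auto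
      also have "\<dots> = 4 * T" using T by (simp add: power_mult_distrib)
      finally have "(norm (z - s *\<^sub>R p))\<^sup>2 / (4 * s) \<le> (4 * T) / (4 * (T / 2))"
        using s T by (intro frac_le) auto
      then have "exp (- 2) \<le> exp (- (norm (z - s *\<^sub>R p))\<^sup>2 / (4 * s))" using T by simp
      moreover have "(4 * pi * T) powr (- q) \<le> (4 * pi * s) powr (- q)"
        using s by (intro powr_mono2') (auto simp: q_def)
      ultimately have "m \<le> gauss s (z - s *\<^sub>R p)"
        unfolding gauss_def m_def q_def minus_divide_left by (intro mult_mono) auto
      then show ?thesis using s True by (simp add: ennreal_leI)
    qed simp
  qed
  finally have le: "ennreal (m * (T - T / 2)) \<le> drift_kernel T z p" .
  have "T powr (1 - q) = 2 * exp 2 * (4 * pi) powr q * (m * (T - T / 2))"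
    using T by (simp add: m_def powr_mult powr_minus_divide powr_diff exp_minus)
  then have "ennreal (T powr (1 - q)) = ennreal (2 * exp 2 * (4 * pi) powr q) * ennreal (m * (T - T / 2))"
    using T m by (simp add: ennreal_mult[symmetric])
  also have "\<dots> \<le> ennreal (2 * exp 2 * (4 * pi) powr q) * drift_kernel T z p"
    using le by (intro mult_left_mono) auto
  finally show ?thesis unfolding q_def .
qed

text \<open>A shift by at most sqrt T is harmless once the variance is doubled: |w|^2 <= 2|z|^2 + 2T
  gives |w|^2/(32T) <= |z|^2/(16T) + 1. The height T^(1-d/2) times the volume of the ball is a
  multiple of T, which matches the left side.\<close>

lemma gauss_le_ball_avg:
  fixes z :: "'a::euclidean_space"
  assumes T: "T > 0"
  shows "ennreal (T * gauss (4 * T) z) \<le> ennreal (exp 1 * 2 powr (real DIM('a) / 2) / unit_ball_vol (real DIM('a))) *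
    (\<integral>\<^sup>+ w. ennreal (gauss (8 * T) w) * (ennreal (T powr (1 - real DIM('a) / 2)) * indicator (cball 0 (sqrt T)) (z - w)) \<partial>lborel)"
proof -
  define q where "q = real DIM('a) / 2"
  define v where "v = unit_ball_vol (real DIM('a))"
  have v: "v > 0" unfolding v_def by simp
  define m where "m = exp (- 1) / 2 powr q * gauss (4 * T) z"
  have m: "m \<ge> 0" by (simp add: m_def gauss_nonneg)
  have lower: "m \<le> gauss (8 * T) w" if w: "norm (z - w) \<le> sqrt T" for w
  proof -
    have "norm w \<le> norm z + sqrt T" using w norm_triangle_ineq2[of w z] by (simp add: norm_minus_commute)
    then have "(norm w)\<^sup>2 \<le> (norm z + sqrt T)\<^sup>2" by (intro power_mono) auto
    also have "\<dots> \<le> 2 * (norm z)\<^sup>2 + 2 * T"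
      using sum_squares_bound[of "norm z" "sqrt T"] T by (simp add: power2_sum)
    finally have "(norm w)\<^sup>2 / (32 * T) \<le> (2 * (norm z)\<^sup>2 + 2 * T) / (32 * T)"
      using T by (intro divide_right_mono) auto
    also have "\<dots> \<le> (norm z)\<^sup>2 / (16 * T) + 1" using T by (simp add: field_simps)
    finally have "exp (- 1 + - (norm z)\<^sup>2 / (16 * T)) \<le> exp (- (norm w)\<^sup>2 / (32 * T))" by simp
    then have e: "exp (- 1) * exp (- (norm z)\<^sup>2 / (16 * T)) \<le> exp (- (norm w)\<^sup>2 / (32 * T))" by (simp only: exp_add)
    have "(4 * pi * (4 * T)) powr (- q) = 2 powr q * (4 * pi * (8 * T)) powr (- q)"
    proof -
      have "4 * pi * (8 * T) = 2 * (4 * pi * (4 * T))" by simp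
      then show ?thesis by (simp only: powr_mult) (simp add: powr_minus_divide)
    qed
    then have "m = (4 * pi * (8 * T)) powr (- q) * (exp (- 1) * exp (- (norm z)\<^sup>2 / (16 * T)))"
      unfolding m_def gauss_def q_def by simp
    also have "\<dots> \<le> (4 * pi * (8 * T)) powr (- q) * exp (- (norm w)\<^sup>2 / (32 * T))"
      using e by (intro mult_left_mono) auto
    finally show ?thesis unfolding gauss_def q_def by simp
  qed
  have "ennreal (m * (T powr (1 - q) * (v * sqrt T ^ DIM('a)))) = (\<integral>\<^sup>+ w. ennreal (m * T powr (1 - q)) * indicator (cball z (sqrt T)) w \<partial>lborel)"
    using T m v by (subst nn_integral_cmult_indicator) (auto simp: emeasure_cball v_def ennreal_mult[symmetric] mult_ac)
  also have "\<dots> \<le> (\<integral>\<^sup>+ w. ennreal (gauss (8 * T) w) * (ennreal (T powr (1 - q)) * indicator (cball 0 (sqrt T)) (z - w)) \<partial>lborel)"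
  proof (rule nn_integral_mono)
    fix w
    show "ennreal (m * T powr (1 - q)) * indicator (cball z (sqrt T)) w \<le> ennreal (gauss (8 * T) w) * (ennreal (T powr (1 - q)) * indicator (cball 0 (sqrt T)) (z - w))"
      using lower[of w] m
      by (auto simp: indicator_def dist_norm norm_minus_commute[of w z] ennreal_mult[symmetric] gauss_nonneg intro!: ennreal_leI mult_right_mono)
  qed
  finally have le: "ennreal (m * (T powr (1 - q) * (v * sqrt T ^ DIM('a)))) \<le> \<dots>" .
  have "sqrt T ^ DIM('a) = T powr q"
    using T by (simp add: q_def powr_half_sqrt[symmetric] powr_power)
  then have "T powr (1 - q) * (v * sqrt T ^ DIM('a)) = v * T"
    using T by (simp add: powr_add[symmetric] mult.left_commute)
  then have "T * gauss (4 * T) z = exp 1 * 2 powr q / v * (m * (T powr (1 - q) * (v * sqrt T ^ DIM('a))))"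
    using v by (simp add: m_def exp_minus field_simps)
  then have "ennreal (T * gauss (4 * T) z) = ennreal (exp 1 * 2 powr q / v) * ennreal (m * (T powr (1 - q) * (v * sqrt T ^ DIM('a))))"
    using v m T by (simp add: ennreal_mult[symmetric])
  also have "\<dots> \<le> ennreal (exp 1 * 2 powr q / v) * (\<integral>\<^sup>+ w. ennreal (gauss (8 * T) w) * (ennreal (T powr (1 - q)) * indicator (cball 0 (sqrt T)) (z - w)) \<partial>lborel)"
    using le by (intro mult_left_mono) auto
  finally show ?thesis unfolding q_def v_def .
qed

section \<open>The drift potential is controlled by the kernel K\<close>

lemma KV_le_Knorm: "KV V T x p \<le> Knorm V T"
  unfolding Knorm_def by (meson SUP_upper2 UNIV_I order_refl)

lemma measurable_drift_kernel [measurable]: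
  assumes [measurable]: "f \<in> borel_measurable M" "g \<in> borel_measurable M"
  shows "(\<lambda>z. drift_kernel T (f z) (g z)) \<in> borel_measurable M"
  unfolding drift_kernel_def by measurable

lemma measurable_indicator_cball:
  fixes f :: "'b \<Rightarrow> 'a::euclidean_space"
  assumes "f \<in> borel_measurable M"
  shows "(\<lambda>x. indicator (cball 0 r) (f x) :: ennreal) \<in> borel_measurable M"
  by (rule measurable_compose[OF assms borel_measurable_indicator]) auto

text \<open>Since T|p| = sqrt T, the ball lies within the cutoff for this p, and there K is
  comparable with the drift kernel, which dominates the indicator. The bound is uniform in the
  centre x.\<close>

lemma nn_integral_ball_le_Knorm:
  fixes V :: "'a::euclidean_space \<Rightarrow> real" and p :: 'a
  assumes [measurable]: "V \<in> borel_measurable borel" and T: "T > 0" and p: "norm p = 1 / sqrt T"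
    and C: "\<And>z. z \<noteq> 0 \<Longrightarrow> norm z \<le> sqrt T \<Longrightarrow> drift_kernel T z p \<le> ennreal C * ennreal (Kker T z p)"
  defines "B \<equiv> 2 * exp 2 * (4 * pi) powr (real DIM('a) / 2)"
  shows "(\<integral>\<^sup>+ z. ennreal (T powr (1 - real DIM('a) / 2)) * indicator (cball 0 (sqrt T)) (z - x) * ennreal \<bar>V z\<bar> \<partial>lborel)
    \<le> ennreal B * ennreal C * Knorm V T"
proof -
  have "(\<integral>\<^sup>+ z. ennreal (T powr (1 - real DIM('a) / 2)) * indicator (cball 0 (sqrt T)) (z - x) * ennreal \<bar>V z\<bar> \<partial>lborel)
    \<le> (\<integral>\<^sup>+ z. ennreal B * ennreal C * (ennreal (Kker T (z - x) p) * ennreal \<bar>V z\<bar>) \<partial>lborel)"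
  proof (rule nn_integral_mono_AE)
    show "AE z in lborel. ennreal (T powr (1 - real DIM('a) / 2)) * indicator (cball 0 (sqrt T)) (z - x) * ennreal \<bar>V z\<bar>
      \<le> ennreal B * ennreal C * (ennreal (Kker T (z - x) p) * ennreal \<bar>V z\<bar>)"
      using AE_lborel_diff_neq_0[of x]
    proof eventually_elim
      case (elim z)
      have "ennreal (T powr (1 - real DIM('a) / 2)) * indicator (cball 0 (sqrt T)) (z - x)
        \<le> ennreal B * (ennreal C * ennreal (Kker T (z - x) p))"
      proof (cases "norm (z - x) \<le> sqrt T")
        case True
        have "ennreal (T powr (1 - real DIM('a) / 2)) \<le> ennreal B * drift_kernel T (z - x) p"
          unfolding B_def by (rule ball_le_drift_kernel[OF T p True])
        also have "\<dots> \<le> ennreal B * (ennreal C * ennreal (Kker T (z - x) p))"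
          using C[OF elim True] by (intro mult_left_mono) auto
        finally show ?thesis by (auto simp: indicator_def)
      next
        case False
        then show ?thesis by (simp add: norm_minus_commute)
      qed
      then show ?case unfolding mult.assoc[symmetric] by (intro mult_right_mono) auto
    qed
  qed
  also have "\<dots> = ennreal B * ennreal C * KV V T x p"
    unfolding KV_eq[OF less_imp_le[OF T]] by (rule nn_integral_cmult) measurable
  also have "\<dots> \<le> ennreal B * ennreal C * Knorm V T"
    by (intro mult_left_mono KV_le_Knorm) auto
  finally show ?thesis .
qed

text \<open>The wide Gaussian never meets K directly: it is dominated by an average of ball
  indicators over centres x + w, each bounded by \<open>Knorm\<close> uniformly in the centre, and
  the averaging weight has mass 1.\<close>

lemma nn_integral_gauss_le_Knorm:
  fixes V :: "'a::euclidean_space \<Rightarrow> real" and p :: 'a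
  assumes V [measurable]: "V \<in> borel_measurable borel" and T: "T > 0" and p: "norm p = 1 / sqrt T"
    and C: "\<And>z. z \<noteq> 0 \<Longrightarrow> norm z \<le> sqrt T \<Longrightarrow> drift_kernel T z p \<le> ennreal C * ennreal (Kker T z p)"
  defines "A \<equiv> exp 1 * 2 powr (real DIM('a) / 2) / unit_ball_vol (real DIM('a))"
    and "B \<equiv> 2 * exp 2 * (4 * pi) powr (real DIM('a) / 2)"
  shows "(\<integral>\<^sup>+ z. ennreal (T * gauss (4 * T) (z - x)) * ennreal \<bar>V z\<bar> \<partial>lborel)
    \<le> ennreal A * ennreal B * ennreal C * Knorm V T"
proof -
  let ?b = "ennreal (T powr (1 - real DIM('a) / 2))"
  note [measurable] = measurable_indicator_cball
  have "(\<integral>\<^sup>+ z. ennreal (T * gauss (4 * T) (z - x)) * ennreal \<bar>V z\<bar> \<partial>lborel)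
    \<le> (\<integral>\<^sup>+ z. ennreal A * (\<integral>\<^sup>+ w. ennreal (gauss (8 * T) w) * (?b * indicator (cball 0 (sqrt T)) (z - (x + w)) * ennreal \<bar>V z\<bar>) \<partial>lborel) \<partial>lborel)"
  proof (rule nn_integral_mono)
    fix z
    define h where "h = (\<lambda>w. ennreal (gauss (8 * T) w) * (?b * indicator (cball 0 (sqrt T)) (z - x - w)))"
    have [measurable]: "h \<in> borel_measurable borel" unfolding h_def by measurable
    have "ennreal (T * gauss (4 * T) (z - x)) \<le> ennreal A * (\<integral>\<^sup>+ w. h w \<partial>lborel)"
      unfolding A_def h_def by (rule gauss_le_ball_avg[OF T])
    then have "ennreal (T * gauss (4 * T) (z - x)) * ennreal \<bar>V z\<bar> \<le> ennreal A * (\<integral>\<^sup>+ w. h w \<partial>lborel) * ennreal \<bar>V z\<bar>"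
      by (rule mult_right_mono) simp
    moreover have "(\<integral>\<^sup>+ w. h w * ennreal \<bar>V z\<bar> \<partial>lborel) = (\<integral>\<^sup>+ w. h w \<partial>lborel) * ennreal \<bar>V z\<bar>"
      by (rule nn_integral_multc) measurable
    ultimately show "ennreal (T * gauss (4 * T) (z - x)) * ennreal \<bar>V z\<bar> \<le>
      ennreal A * (\<integral>\<^sup>+ w. ennreal (gauss (8 * T) w) * (?b * indicator (cball 0 (sqrt T)) (z - (x + w)) * ennreal \<bar>V z\<bar>) \<partial>lborel)"
      by (simp only: h_def mult.assoc diff_diff_eq)
  qed
  also have "\<dots> = ennreal A * (\<integral>\<^sup>+ z. \<integral>\<^sup>+ w. ennreal (gauss (8 * T) w) * (?b * indicator (cball 0 (sqrt T)) (z - (x + w)) * ennreal \<bar>V z\<bar>) \<partial>lborel \<partial>lborel)"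
    by (rule nn_integral_cmult) measurable
  also have "(\<integral>\<^sup>+ z. \<integral>\<^sup>+ w. ennreal (gauss (8 * T) w) * (?b * indicator (cball 0 (sqrt T)) (z - (x + w)) * ennreal \<bar>V z\<bar>) \<partial>lborel \<partial>lborel)
    = (\<integral>\<^sup>+ w. \<integral>\<^sup>+ z. ennreal (gauss (8 * T) w) * (?b * indicator (cball 0 (sqrt T)) (z - (x + w)) * ennreal \<bar>V z\<bar>) \<partial>lborel \<partial>lborel)"
    by (rule lborel_pair.Fubini'[symmetric]) measurable
  also have "\<dots> = (\<integral>\<^sup>+ w. ennreal (gauss (8 * T) w) * (\<integral>\<^sup>+ z. ?b * indicator (cball 0 (sqrt T)) (z - (x + w)) * ennreal \<bar>V z\<bar> \<partial>lborel) \<partial>lborel)"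
    by (intro nn_integral_cong nn_integral_cmult) measurable
  also have "\<dots> \<le> (\<integral>\<^sup>+ (w :: 'a). ennreal (gauss (8 * T) w) * (ennreal B * ennreal C * Knorm V T) \<partial>lborel)"
  proof (rule nn_integral_mono)
    fix w
    have "(\<integral>\<^sup>+ z. ?b * indicator (cball 0 (sqrt T)) (z - (x + w)) * ennreal \<bar>V z\<bar> \<partial>lborel) \<le> ennreal B * ennreal C * Knorm V T"
      unfolding B_def by (rule nn_integral_ball_le_Knorm[OF V T p]) (rule C)
    then show "ennreal (gauss (8 * T) w) * (\<integral>\<^sup>+ z. ?b * indicator (cball 0 (sqrt T)) (z - (x + w)) * ennreal \<bar>V z\<bar> \<partial>lborel)
      \<le> ennreal (gauss (8 * T) w) * (ennreal B * ennreal C * Knorm V T)"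
      by (rule mult_left_mono) simp
  qed
  also have "\<dots> = ennreal B * ennreal C * Knorm V T"
    using T by (subst nn_integral_multc) (auto simp: nn_integral_gauss)
  finally show ?thesis by (simp add: mult.assoc mult_left_mono)
qed

text \<open>The kernel is split along the cutoff for p. Inside, K with the same p suffices and
  contributes the summand C of D; outside, K with the auxiliary vector e and the wide Gaussian take
  over and contribute the rest.\<close>

lemma drift_norm_le_Knorm:
  fixes V :: "'a::euclidean_space \<Rightarrow> real"
  assumes V [measurable]: "V \<in> borel_measurable borel" and T: "T > 0" and C0: "C \<ge> 0"
    and C: "\<And>z p :: 'a. z \<noteq> 0 \<Longrightarrow> norm z \<le> T * norm p \<Longrightarrow> drift_kernel T z p \<le> ennreal C * ennreal (Kker T z p)"
  defines "q \<equiv> real DIM('a) / 2"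
  defines "D \<equiv> C + 4 powr q * (exp 1 * C + 2 * (4 powr q * (8 * (q + 1)) powr q) *
      (exp 1 * 2 powr q / unit_ball_vol (real DIM('a)) * (2 * exp 2 * (4 * pi) powr q) * C))"
  shows "drift_norm V (T / 2) \<le> ennreal D * Knorm V T"
  unfolding drift_norm_def
proof (intro SUP_least)
  fix x p :: 'a
  define G where "G = 2 * (4 powr q * (8 * (q + 1)) powr q)"
  define A where "A = exp 1 * 2 powr q / unit_ball_vol (real DIM('a))"
  define B where "B = 2 * exp 2 * (4 * pi) powr q"
  have nonneg: "G \<ge> 0" "A \<ge> 0" "B \<ge> 0" by (auto simp: G_def A_def B_def)
  obtain b :: 'a where b: "b \<in> Basis" using nonempty_Basis by blast
  \<comment> \<open>The direction of e is immaterial; its length makes T|e| = sqrt T.\<close>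
  define e where "e = (1 / sqrt T) *\<^sub>R b"
  have e: "norm e = 1 / sqrt T" using b T by (simp add: e_def)
  have Te: "T * norm e = sqrt T" using T by (simp add: e real_div_sqrt)
  have Ce: "drift_kernel T z e \<le> ennreal C * ennreal (Kker T z e)" if "z \<noteq> 0" "norm z \<le> sqrt T" for z
    using C[of z e] that by (simp add: Te)
  have "drift_potential V (T / 2) x p \<le> (\<integral>\<^sup>+ z. ennreal C * (ennreal (Kker T (z - x) p) * ennreal \<bar>V z\<bar>) +
     ennreal (4 powr q) * (ennreal (exp 1 * C) * (ennreal (Kker T (z - x) e) * ennreal \<bar>V z\<bar>)
       + ennreal G * (ennreal (T * gauss (4 * T) (z - x)) * ennreal \<bar>V z\<bar>)) \<partial>lborel)"
    unfolding drift_potential_eq[OF V]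
  proof (rule nn_integral_mono_AE)
    show "AE z in lborel. drift_kernel (T / 2) (z - x) p * ennreal \<bar>V z\<bar> \<le>
     ennreal C * (ennreal (Kker T (z - x) p) * ennreal \<bar>V z\<bar>) +
     ennreal (4 powr q) * (ennreal (exp 1 * C) * (ennreal (Kker T (z - x) e) * ennreal \<bar>V z\<bar>)
       + ennreal G * (ennreal (T * gauss (4 * T) (z - x)) * ennreal \<bar>V z\<bar>))"
      using AE_lborel_diff_neq_0[of x]
    proof eventually_elim
      case (elim z)
      define u where "u = z - x"
      have u: "u \<noteq> 0" using elim by (simp add: u_def)
      have "drift_kernel (T / 2) u p \<le> ennreal C * ennreal (Kker T u p) +
        ennreal (4 powr q) * (ennreal (exp 1 * C) * ennreal (Kker T u e) + ennreal G * ennreal (T * gauss (4 * T) u))"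
      proof (cases "norm u \<le> T * norm p")
        case True
        have "drift_kernel (T / 2) u p \<le> drift_kernel T u p"
          unfolding drift_kernel_def using T by (intro nn_integral_mono) (auto simp: indicator_def)
        also have "\<dots> \<le> ennreal C * ennreal (Kker T u p)" by (rule C[OF u True])
        finally show ?thesis by (rule order_trans) (simp add: add_increasing2)
      next
        case False
        have near: "drift_kernel T u e * indicator (cball 0 (sqrt T)) u \<le> ennreal C * ennreal (Kker T u e)"
          using Ce[OF u] by (auto simp: indicator_def)
        have "drift_kernel (T / 2) u p \<le> ennreal (4 powr q) * drift_kernel (2 * T) u 0"
          unfolding q_def using False by (intro drift_kernel_half_le T) auto
        also have "\<dots> \<le> ennreal (4 powr q) * (ennreal (exp 1) * (drift_kernel T u e * indicator (cball 0 (sqrt T)) u)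
            + ennreal G * ennreal (T * gauss (4 * T) u))"
          unfolding G_def q_def by (intro mult_left_mono drift_kernel_zero_le T e) auto
        also have "\<dots> \<le> ennreal (4 powr q) * (ennreal (exp 1) * (ennreal C * ennreal (Kker T u e)) + ennreal G * ennreal (T * gauss (4 * T) u))"
          using near by (intro mult_left_mono add_right_mono) auto
        also have "\<dots> = ennreal (4 powr q) * (ennreal (exp 1 * C) * ennreal (Kker T u e) + ennreal G * ennreal (T * gauss (4 * T) u))"
          using C0 by (simp add: ennreal_mult mult.assoc)
        finally show ?thesis by (rule order_trans) (simp add: add_increasing)
      qed
      then have "drift_kernel (T / 2) u p * ennreal \<bar>V z\<bar> \<le> (ennreal C * ennreal (Kker T u p) +
        ennreal (4 powr q) * (ennreal (exp 1 * C) * ennreal (Kker T u e) + ennreal G * ennreal (T * gauss (4 * T) u))) * ennreal \<bar>V z\<bar>"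
        by (rule mult_right_mono) simp
      then show ?case by (simp only: u_def distrib_right mult.assoc)
    qed
  qed
  also have "\<dots> = ennreal C * KV V T x p + ennreal (4 powr q) * (ennreal (exp 1 * C) * KV V T x e
      + ennreal G * (\<integral>\<^sup>+ z. ennreal (T * gauss (4 * T) (z - x)) * ennreal \<bar>V z\<bar> \<partial>lborel))"
    unfolding KV_eq[OF less_imp_le[OF T]] by (simp add: nn_integral_add nn_integral_cmult)
  also have "\<dots> \<le> ennreal C * Knorm V T + ennreal (4 powr q) * (ennreal (exp 1 * C) * Knorm V T
      + ennreal G * (ennreal A * ennreal B * ennreal C * Knorm V T))"
    unfolding A_def B_def q_def
    by (intro add_mono mult_left_mono KV_le_Knorm nn_integral_gauss_le_Knorm[OF V T e Ce]) auto
  also have "\<dots> = ennreal (C + 4 powr q * (exp 1 * C + G * (A * B * C))) * Knorm V T"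
    using C0 nonneg by (simp add: ennreal_plus[symmetric] ennreal_mult[symmetric] mult.assoc[symmetric] distrib_right[symmetric] del: ennreal_plus)
  also have "C + 4 powr q * (exp 1 * C + G * (A * B * C)) = D"
    unfolding D_def G_def A_def B_def ..
  finally show "drift_potential V (T / 2) x p \<le> ennreal D * Knorm V T" .
qed

lemma ennreal_le_imp_scaled_le:
  fixes x y :: ennreal
  assumes "c > 0" "x \<le> ennreal c * y"
  shows "ennreal (1 / c) * x \<le> y"
proof -
  have "ennreal (1 / c) * x \<le> ennreal (1 / c) * (ennreal c * y)"
    using assms by (intro mult_left_mono) auto
  also have "\<dots> = y"
    using assms by (simp add: mult.assoc[symmetric] ennreal_mult[symmetric])
  finally show ?thesis .
qed

theorem theorem3p1:
  "\<exists>C1 C2 :: real. 0 < C1 \<and> C1 < C2 \<and>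
     (\<forall>T > 0. \<forall>V :: 'a::euclidean_space \<Rightarrow> real. V \<in> borel_measurable borel \<longrightarrow>
        ennreal C1 * Knorm V T \<le> Snorm V T \<and> Snorm V T \<le> ennreal C2 * Knorm V T)"
proof -
  let ?q = "real DIM('a) / 2"
  obtain c C where c: "c > 0" and C: "C > 0" and K: "\<forall>T > 0. \<forall>z p :: 'a. z \<noteq> 0 \<longrightarrow> norm z \<le> T * norm p \<longrightarrow>
    ennreal (Kker T z p) \<le> ennreal c * drift_kernel T z p \<and> drift_kernel T z p \<le> ennreal (C * Kker T z p)"
    using Kker_comparable by blast
  \<comment> \<open>The 4 comes from doubling twice, from the horizon T/4 up to T; the power of 2
    comes from narrowing the bridge Gaussian.\<close>
  define L where "L = c * (4 * 2 powr ?q)"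
  define D where "D = C + 4 powr ?q * (exp 1 * C + 2 * (4 powr ?q * (8 * (?q + 1)) powr ?q) *
      (exp 1 * 2 powr ?q / unit_ball_vol (real DIM('a)) * (2 * exp 2 * (4 * pi) powr ?q) * C))"
  define U where "U = 2 * 2 powr ?q * D"
  have L: "L > 0" using c by (simp add: L_def)
  have "D > 0" unfolding D_def using C by (intro add_pos_nonneg) auto
  then have U: "U > 0" by (simp add: U_def)
  have lower: "ennreal (1 / L) * Knorm V T \<le> Snorm V T"
    if T: "T > 0" and V: "V \<in> borel_measurable borel" for T and V :: "'a \<Rightarrow> real"
  proof -
    have "Knorm V T \<le> ennreal c * drift_norm V T"
      using K T by (intro Knorm_le_drift_norm[OF V T]) auto
    also have "drift_norm V T \<le> 2 * (2 * drift_norm V (T / 4))"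
    proof -
      have "drift_norm V T \<le> 2 * drift_norm V (T / 2)" using drift_norm_double[OF V, of "T / 2"] T by simp
      also have "drift_norm V (T / 2) \<le> 2 * drift_norm V (T / 4)" using drift_norm_double[OF V, of "T / 4"] T by simp
      finally show ?thesis by (simp add: mult_left_mono)
    qed
    also have "drift_norm V (T / 4) \<le> ennreal (2 powr ?q) * Snorm V T"
      by (rule drift_norm_le_Snorm[OF V T])
    finally have "Knorm V T \<le> ennreal c * (2 * (2 * (ennreal (2 powr ?q) * Snorm V T)))"
      by (simp add: mult_left_mono)
    also have "\<dots> = ennreal L * Snorm V T"
      using c by (simp add: L_def ennreal_mult mult.assoc[symmetric])
    finally show ?thesis by (rule ennreal_le_imp_scaled_le[OF L])
  qed
  have upper: "Snorm V T \<le> ennreal U * Knorm V T"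
    if T: "T > 0" and V: "V \<in> borel_measurable borel" for T and V :: "'a \<Rightarrow> real"
  proof -
    have "drift_norm V (T / 2) \<le> ennreal D * Knorm V T"
      unfolding D_def
    proof (rule drift_norm_le_Knorm[OF V T])
      fix z p :: 'a assume "z \<noteq> 0" "norm z \<le> T * norm p"
      then show "drift_kernel T z p \<le> ennreal C * ennreal (Kker T z p)"
        using K T C by (simp add: ennreal_mult[symmetric] Kker_nonneg)
    qed (use C in auto)
    then have "ennreal (2 * 2 powr ?q) * drift_norm V (T / 2) \<le> ennreal (2 * 2 powr ?q) * (ennreal D * Knorm V T)"
      by (intro mult_left_mono) auto
    also have "\<dots> = ennreal U * Knorm V T"
      using \<open>D > 0\<close> by (simp add: U_def ennreal_mult mult.assoc)
    finally show ?thesis using Snorm_le_drift_norm[OF V, of T] by (rule order_trans[rotated])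
  qed
  \<comment> \<open>Adding 1/L to U makes C1 < C2 strict without comparing the two
    constants.\<close>
  have "Snorm V T \<le> ennreal (U + 1 / L) * Knorm V T"
    if "T > 0" "V \<in> borel_measurable borel" for T and V :: "'a \<Rightarrow> real"
  proof -
    have "ennreal U * Knorm V T \<le> ennreal (U + 1 / L) * Knorm V T"
      using L by (intro mult_right_mono ennreal_leI) auto
    with upper[OF that] show ?thesis by (rule order_trans)
  qed
  then show ?thesis
    using lower L U by (intro exI[of _ "1 / L"] exI[of _ "U + 1 / L"]) auto
qed

end
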